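(* Let $A$ be a finite-dimensional real associative algebra with unit and let $S=\{a\in A: a^2=-1\}$. Then: (1) $S$ is a real algebraic subset of $A$ which is smooth (a smooth embedded submanifold of $A$, possibly with connected components of different dimensions); (2) the almost complex structure $J_S$ on $S$ induced by left multiplication, $J_S(s,h)=(s,sh)$ for $s\in S$, $h\in T_sS$, is integrable; (3) the map $s\mapsto\mathcal W(L_s)$, sending $s$ to the $(-i)$-eigenspace of the complexification of $L_s$, is a biholomorphism of $(S,J_S)$ onto a complex submanifold of the complex Grassmannian $\mathrm{Gr}_{\mathbb C}(\tfrac12\dim_{\mathbb R}A,\ \mathbb C\otimes_{\mathbb R} A)$.
   Context: For $a\in A$, $L_a\in\mathrm{End}_{\mathbb R}(A)$ is left multiplication $L_a(x)=ax$. The tensor product $\mathbb C\otimes A$ is over $\mathbb R$, with complex structure coming from the factor $\mathbb C$. For $J\in\mathrm{End}_{\mathbb R}(A)$ with $J^2=-\mathrm{Id}$, $\mathcal W(J)=\{1\otimes v+i\otimes Jv: v\in A\}\subset\mathbb C\otimes A$, which is the $(-i)$-eigenspace of the complexification of $J$. Tangent spaces $T_sS$ are regarded as subspaces of $A$. If $S$ is empty (e.g. if $\dim_{\mathbb R}A$ is odd) the statement is vacuous. *)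

theory Defs
  imports "HOL-Analysis.Analysis"
begin

section \<open>Smooth maps and submanifolds of Euclidean spaces\<close>

text \<open>\<open>Ck_on k U f\<close>, meant for open \<open>U\<close> in a finite-dimensional space: all iterated directional
  derivatives of order at most \<open>k\<close> exist and are continuous.\<close>

primrec Ck_on :: "nat \<Rightarrow> 'a::euclidean_space set \<Rightarrow> ('a \<Rightarrow> 'b::real_normed_vector) \<Rightarrow> bool" where
  "Ck_on 0 U f \<longleftrightarrow> continuous_on U f"
| "Ck_on (Suc k) U f \<longleftrightarrow>
     (\<forall>x\<in>U. f differentiable (at x)) \<and> (\<forall>v. Ck_on k U (\<lambda>x. frechet_derivative f (at x) v))"

text \<open>A map on an arbitrary subset is smooth if it extends, locally around each point of the
  subset, to a \<open>C\<^sup>\<infinity>\<close> map on an open subset of the ambient space.\<close>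

definition smooth_on :: "'a::euclidean_space set \<Rightarrow> ('a \<Rightarrow> 'b::real_normed_vector) \<Rightarrow> bool" where
  "smooth_on X f \<longleftrightarrow>
     (\<forall>p\<in>X. \<exists>U g. open U \<and> p \<in> U \<and> (\<forall>k. Ck_on k U g) \<and> (\<forall>x\<in>X \<inter> U. g x = f x))"

definition diffeomorphism ::
    "'a::euclidean_space set \<Rightarrow> 'b::euclidean_space set \<Rightarrow> ('a \<Rightarrow> 'b) \<Rightarrow> ('b \<Rightarrow> 'a) \<Rightarrow> bool" where
  "diffeomorphism X Y f g \<longleftrightarrow> homeomorphism X Y f g \<and> smooth_on X f \<and> smooth_on Y g"

text \<open>Embedded submanifolds via slice charts; the local model \<open>E\<close>, and with it the dimension,
  may depend on the point.\<close>

definition smooth_submanifold :: "'a::euclidean_space set \<Rightarrow> bool" where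
  "smooth_submanifold M \<longleftrightarrow>
     (\<forall>p\<in>M. \<exists>U (V :: 'a set) \<Phi> \<Psi> E.
        open U \<and> p \<in> U \<and> open V \<and> diffeomorphism U V \<Phi> \<Psi> \<and> subspace E \<and> \<Phi> ` (U \<inter> M) = V \<inter> E)"

definition tangent_space :: "'a::euclidean_space set \<Rightarrow> 'a \<Rightarrow> 'a set" where
  "tangent_space M p =
     {v. \<exists>\<gamma> \<epsilon>. \<epsilon> > 0 \<and> smooth_on {-\<epsilon><..<\<epsilon>} \<gamma> \<and> \<gamma> ` {-\<epsilon><..<\<epsilon>} \<subseteq> M \<and> \<gamma> 0 = p \<and>
        (\<gamma> has_vector_derivative v) (at (0::real))}"

definition real_algebraic_set :: "'a::euclidean_space set \<Rightarrow> bool" where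
  "real_algebraic_set X \<longleftrightarrow>
     (\<exists>F. finite F \<and> (\<forall>f\<in>F. real_polynomial_function f) \<and> X = {x. \<forall>f\<in>F. f x = 0})"


section \<open>Complex manifolds\<close>

text \<open>A finite-dimensional complex vector space is given as a real subspace \<open>E\<close> of some real normed
  space together with an endomorphism \<open>I\<close> of \<open>E\<close>, multiplication by the imaginary unit. Such pairs
  \<open>(E, I)\<close> replace \<open>\<complex>\<^sup>n\<close> as models of charts, so that the dimension may vary.\<close>

definition complex_structure_on :: "'e::real_vector set \<Rightarrow> ('e \<Rightarrow> 'e) \<Rightarrow> bool" where
  "complex_structure_on E I \<longleftrightarrow> subspace E \<and>
     (\<forall>x\<in>E. \<forall>y\<in>E. \<forall>a b. I (a *\<^sub>R x + b *\<^sub>R y) = a *\<^sub>R I x + b *\<^sub>R I y) \<and>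
     (\<forall>x\<in>E. I x \<in> E \<and> I (I x) = - x)"

record ('x, 'e) cchart =
  cdom :: "'x set"
  cmap :: "'x \<Rightarrow> 'e"
  cmodel :: "'e set"
  cstruct :: "'e \<Rightarrow> 'e"

definition complex_chart :: "('x, 'e::real_normed_vector) cchart \<Rightarrow> bool" where
  "complex_chart c \<longleftrightarrow> complex_structure_on (cmodel c) (cstruct c) \<and>
     inj_on (cmap c) (cdom c) \<and> openin (top_of_set (cmodel c)) (cmap c ` cdom c)"

text \<open>Holomorphy of a map on a relatively open subset \<open>W\<close> of \<open>(E, I)\<close> with values in a complex
  vector space with structure \<open>K\<close>: the Frechet derivative exists and is complex linear. Here \<open>D\<close> is
  determined by \<open>f\<close> only on \<open>E\<close>.\<close>

definition holo_on ::
    "'e::real_normed_vector set \<Rightarrow> ('e \<Rightarrow> 'e) \<Rightarrow> ('f::real_normed_vector \<Rightarrow> 'f) \<Rightarrow>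
     'e set \<Rightarrow> ('e \<Rightarrow> 'f) \<Rightarrow> bool" where
  "holo_on E I K W f \<longleftrightarrow>
     (\<forall>x\<in>W. \<exists>D. (f has_derivative D) (at x within W) \<and> (\<forall>v\<in>E. D (I v) = K (D v)))"

text \<open>The topology of a complex manifold is the one induced by its atlas; the \<open>openin\<close> condition,
  over all pairs of charts, is continuity of \<open>f\<close>.\<close>

definition holo_in_charts ::
    "('x, 'e::real_normed_vector) cchart \<Rightarrow> ('y, 'f::real_normed_vector) cchart \<Rightarrow>
     ('x \<Rightarrow> 'y) \<Rightarrow> bool" where
  "holo_in_charts c d f \<longleftrightarrow>
     (let W = cmap c ` {x \<in> cdom c. f x \<in> cdom d}
      in openin (top_of_set (cmodel c)) W \<and>
         holo_on (cmodel c) (cstruct c) (cstruct d) W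
           (\<lambda>z. cmap d (f (inv_into (cdom c) (cmap c) z))))"

definition compatible_charts ::
    "('x, 'e::real_normed_vector) cchart \<Rightarrow> ('x, 'e) cchart \<Rightarrow> bool" where
  "compatible_charts c d \<longleftrightarrow> holo_in_charts c d (\<lambda>x. x) \<and> holo_in_charts d c (\<lambda>x. x)"

definition complex_atlas :: "('x, 'e::real_normed_vector) cchart set \<Rightarrow> bool" where
  "complex_atlas \<A> \<longleftrightarrow> (\<forall>c\<in>\<A>. complex_chart c) \<and> (\<forall>c\<in>\<A>. \<forall>d\<in>\<A>. compatible_charts c d)"

definition atlas_carrier :: "('x, 'e) cchart set \<Rightarrow> 'x set" where
  "atlas_carrier \<A> = (\<Union>c\<in>\<A>. cdom c)"

definition maximal_atlas ::
    "('x, 'e::real_normed_vector) cchart set \<Rightarrow> ('x, 'e) cchart set" where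
  "maximal_atlas \<A> =
     {c. complex_chart c \<and> cdom c \<subseteq> atlas_carrier \<A> \<and> (\<forall>d\<in>\<A>. compatible_charts c d)}"

definition holomorphic_map ::
    "('x, 'e::real_normed_vector) cchart set \<Rightarrow> ('y, 'f::real_normed_vector) cchart set \<Rightarrow>
     ('x \<Rightarrow> 'y) \<Rightarrow> bool" where
  "holomorphic_map \<A> \<B> f \<longleftrightarrow> f ` atlas_carrier \<A> \<subseteq> atlas_carrier \<B> \<and>
     (\<forall>c\<in>\<A>. \<forall>d\<in>\<B>. holo_in_charts c d f)"

definition biholomorphism ::
    "('x, 'e::real_normed_vector) cchart set \<Rightarrow> ('y, 'f::real_normed_vector) cchart set \<Rightarrow>
     ('x \<Rightarrow> 'y) \<Rightarrow> bool" where
  "biholomorphism \<A> \<B> f \<longleftrightarrow> bij_betw f (atlas_carrier \<A>) (atlas_carrier \<B>) \<and>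
     holomorphic_map \<A> \<B> f \<and> holomorphic_map \<B> \<A> (inv_into (atlas_carrier \<A>) f)"

text \<open>Charts of the ambient manifold that flatten \<open>M\<close> to a complex subspace \<open>F\<close> of the model,
  restricted to \<open>M\<close>. They form the atlas of \<open>M\<close> as a complex submanifold.\<close>

definition submanifold_atlas ::
    "('x, 'e::real_normed_vector) cchart set \<Rightarrow> 'x set \<Rightarrow> ('x, 'e) cchart set" where
  "submanifold_atlas \<A> M =
     {c\<lparr>cdom := cdom c \<inter> M, cmodel := F\<rparr> | c F.
        c \<in> maximal_atlas \<A> \<and> subspace F \<and> F \<subseteq> cmodel c \<and> cstruct c ` F \<subseteq> F \<and>
        cmap c ` (cdom c \<inter> M) = cmap c ` cdom c \<inter> F}"

definition complex_submanifold ::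
    "('x, 'e::real_normed_vector) cchart set \<Rightarrow> 'x set \<Rightarrow> bool" where
  "complex_submanifold \<A> M \<longleftrightarrow> complex_atlas \<A> \<and> atlas_carrier (submanifold_atlas \<A> M) = M"


section \<open>Almost complex structures\<close>

text \<open>An almost complex structure is given by its fibre maps \<open>J p\<close> on the tangent spaces.\<close>

definition almost_complex_structure ::
    "'a::euclidean_space set \<Rightarrow> ('a \<Rightarrow> 'a \<Rightarrow> 'a) \<Rightarrow> bool" where
  "almost_complex_structure M J \<longleftrightarrow>
     (\<forall>p\<in>M. complex_structure_on (tangent_space M p) (J p)) \<and>
     smooth_on {(p, v). p \<in> M \<and> v \<in> tangent_space M p} (\<lambda>(p, v). J p v)"

text \<open>Smooth charts of \<open>M\<close> whose differential intertwines \<open>J\<close> with the complex structure of the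
  model. The model is a complex vector space inside \<open>'a\<close>, which leaves room for every dimension
  that \<open>M\<close> can have. Only the values of \<open>D\<close> on the tangent space are determined.\<close>

definition holomorphic_charts ::
    "'a::euclidean_space set \<Rightarrow> ('a \<Rightarrow> 'a \<Rightarrow> 'a) \<Rightarrow> ('a, 'a) cchart set" where
  "holomorphic_charts M J =
     {c. complex_chart c \<and> openin (top_of_set M) (cdom c) \<and>
         (\<exists>\<psi>. diffeomorphism (cdom c) (cmap c ` cdom c) (cmap c) \<psi>) \<and>
         (\<forall>p\<in>cdom c. \<exists>D. (cmap c has_derivative D) (at p within M) \<and>
            (\<forall>v\<in>tangent_space M p. D (J p v) = cstruct c (D v)))}"

definition integrable_structure ::
    "'a::euclidean_space set \<Rightarrow> ('a \<Rightarrow> 'a \<Rightarrow> 'a) \<Rightarrow> bool" where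
  "integrable_structure M J \<longleftrightarrow> (\<forall>p\<in>M. \<exists>c\<in>holomorphic_charts M J. p \<in> cdom c)"


section \<open>Complexification and complex Grassmannians\<close>

text \<open>The complexification of \<open>'a\<close>, i.e. its tensor product over the reals with \<open>\<complex>\<close>, is realised
  on \<open>'a \<times> 'a\<close>: the pair \<open>(v, w)\<close> stands for \<open>1 \<otimes> v + i \<otimes> w\<close>.\<close>

type_synonym 'a complexification = "'a \<times> 'a"

definition scaleC :: "complex \<Rightarrow> 'a::real_vector complexification \<Rightarrow> 'a complexification" where
  "scaleC c x = (Re c *\<^sub>R fst x - Im c *\<^sub>R snd x, Re c *\<^sub>R snd x + Im c *\<^sub>R fst x)"

definition ctensor :: "complex \<Rightarrow> 'a::real_vector \<Rightarrow> 'a complexification" where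
  "ctensor c v = (Re c *\<^sub>R v, Im c *\<^sub>R v)"

definition complexified_map :: "('a \<Rightarrow> 'a) \<Rightarrow> 'a complexification \<Rightarrow> 'a complexification" where
  "complexified_map T = map_prod T T"

definition \<W> :: "('a::real_vector \<Rightarrow> 'a) \<Rightarrow> 'a complexification set" where
  "\<W> J = {ctensor 1 v + ctensor \<i> (J v) | v. True}"

lemma vector_space_scaleC: "vector_space scaleC"
  by unfold_locales (auto simp: scaleC_def algebra_simps)

lemma scaleC_ctensor: "scaleC c (ctensor d v) = ctensor (c * d) v"
  by (simp add: scaleC_def ctensor_def algebra_simps)

lemma complexified_map_ctensor:
  "linear T \<Longrightarrow> complexified_map T (ctensor c v) = ctensor c (T v)"
  by (simp add: complexified_map_def ctensor_def linear_cmul)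

lemma \<W>_eigenspace:
  assumes "linear J" and "\<And>v. J (J v) = - v"
  shows "\<W> J = {x. complexified_map J x = scaleC (- \<i>) x}"
  using assms(2) by (force simp: \<W>_def complexified_map_def scaleC_def ctensor_def)

text \<open>\<open>complex_grassmannian k\<close> is the set of complex subspaces of complex dimension \<open>k\<close> of the
  complexification of \<open>'a\<close>.\<close>

definition complex_grassmannian :: "nat \<Rightarrow> 'a::euclidean_space complexification set set" where
  "complex_grassmannian k = {W. module.subspace scaleC W \<and> vector_space.dim scaleC W = k}"

definition complementary :: "'v::real_vector set \<Rightarrow> 'v set \<Rightarrow> bool" where
  "complementary P Q \<longleftrightarrow> P \<inter> Q = {0} \<and> (\<forall>v. \<exists>p\<in>P. \<exists>q\<in>Q. v = p + q)"

text \<open>For complementary \<open>P\<close> and \<open>Q\<close>, the complex linear maps from \<open>P\<close> to \<open>Q\<close>, extended by zero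
  on \<open>Q\<close>, so that they lie in one normed space.\<close>

definition complex_hom ::
    "'a::euclidean_space complexification set \<Rightarrow> 'a complexification set \<Rightarrow>
     ('a complexification \<Rightarrow>\<^sub>L 'a complexification) set" where
  "complex_hom P Q =
     {T. (\<forall>c x. blinfun_apply T (scaleC c x) = scaleC c (blinfun_apply T x)) \<and>
         (\<forall>x. blinfun_apply T x \<in> Q) \<and> (\<forall>x\<in>Q. blinfun_apply T x = 0)}"

text \<open>The standard affine chart of the Grassmannian: a complement \<open>W\<close> of \<open>Q\<close> is the graph of a
  unique complex linear map from \<open>P\<close> to \<open>Q\<close>.\<close>

definition grassmannian_chart ::
    "nat \<Rightarrow> 'a::euclidean_space complexification set \<Rightarrow> 'a complexification set \<Rightarrow>
     ('a complexification set, 'a complexification \<Rightarrow>\<^sub>L 'a complexification) cchart" where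
  "grassmannian_chart k P Q =
     \<lparr>cdom = {W \<in> complex_grassmannian k. complementary W Q},
      cmap = (\<lambda>W. THE T. T \<in> complex_hom P Q \<and> W = {p + blinfun_apply T p | p. p \<in> P}),
      cmodel = complex_hom P Q,
      cstruct = (\<lambda>T. Blinfun (\<lambda>x. scaleC \<i> (blinfun_apply T x)))\<rparr>"

definition grassmannian_atlas ::
    "nat \<Rightarrow> ('a::euclidean_space complexification set,
              'a complexification \<Rightarrow>\<^sub>L 'a complexification) cchart set" where
  "grassmannian_atlas k =
     {grassmannian_chart k P Q | P Q.
        P \<in> complex_grassmannian k \<and> module.subspace scaleC Q \<and> complementary P Q}"

lemma complex_complement_exists:
  fixes W :: "'a::real_vector complexification set"
  assumes "module.subspace scaleC W"
  shows "\<exists>Q. module.subspace scaleC Q \<and> complementary W Q"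
proof -
  interpret V: vector_space "scaleC :: complex \<Rightarrow> 'a \<times> 'a \<Rightarrow> 'a \<times> 'a"
    by (rule vector_space_scaleC)
  obtain B where B: "B \<subseteq> W" "V.independent B" "W \<subseteq> V.span B"
    using V.maximal_independent_subset by blast
  have W: "W = V.span B"
    using B assms V.span_minimal by blast
  define C where "C = V.extend_basis B"
  have C: "B \<subseteq> C" "V.independent C" "V.span C = UNIV"
    unfolding C_def using B(2) V.extend_basis_superset V.independent_extend_basis V.span_extend_basis
    by blast+
  have "V.span (B \<union> (C - B)) = UNIV"
    using C by (simp add: Un_absorb1)
  then have sum: "\<exists>p\<in>W. \<exists>q\<in>V.span (C - B). v = p + q" for v
    using V.span_Un[of B "C - B"] W by blast
  have "x = 0" if x: "x \<in> W" "x \<in> V.span (C - B)" for x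
  proof -
    have "V.representation C x = V.representation B x"
      using V.representation_extend[OF C(2), of x B] x(1) C(1) W by simp
    moreover have "V.representation C x = V.representation (C - B) x"
      using V.representation_extend[OF C(2) x(2)] by blast
    ultimately have zero: "V.representation C x b = 0" for b
      by (metis DiffE V.representation_ne_zero)
    have "x \<in> V.span C"
      using C(3) by simp
    from V.sum_nonzero_representation_eq[OF C(2) this] show "x = 0"
      using zero by simp
  qed
  moreover have "0 \<in> W"
    using W V.span_zero by simp
  ultimately have "complementary W (V.span (C - B))"
    unfolding complementary_def using sum V.span_zero by auto
  then show ?thesis
    using V.subspace_span by blast
qed

lemma atlas_carrier_grassmannian:
  "atlas_carrier (grassmannian_atlas k) =
     (complex_grassmannian k :: 'a::euclidean_space complexification set set)" (is "_ = ?G")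
proof
  show "atlas_carrier (grassmannian_atlas k) \<subseteq> ?G"
    by (auto simp: atlas_carrier_def grassmannian_atlas_def grassmannian_chart_def)
next
  show "?G \<subseteq> atlas_carrier (grassmannian_atlas k)"
  proof
    fix W :: "'a complexification set"
    assume W: "W \<in> complex_grassmannian k"
    then obtain Q where "module.subspace scaleC Q" "complementary W Q"
      using complex_complement_exists by (auto simp: complex_grassmannian_def)
    with W have "grassmannian_chart k W Q \<in> grassmannian_atlas k"
      unfolding grassmannian_atlas_def by blast
    moreover have "W \<in> cdom (grassmannian_chart k W Q)"
      using W \<open>complementary W Q\<close> by (simp add: grassmannian_chart_def)
    ultimately show "W \<in> atlas_carrier (grassmannian_atlas k)"
      unfolding atlas_carrier_def by blast
  qed
qed


section \<open>Imaginary units of an algebra\<close>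

definition imaginary_units :: "'a::real_algebra_1 set" where
  "imaginary_units = {a. a\<^sup>2 = - 1}"

end

theory Submission
  imports Defs
begin

text \<open>For imaginary units \<open>s\<close> and \<open>x\<close> the Cayley transform
  \<open>t = (1 + s x) (1 - s x)\<^sup>-\<^sup>1\<close>, with inverse \<open>x = s (1 - t) (1 + t)\<^sup>-\<^sup>1\<close>, anticommutes with \<open>s\<close>;
  conversely, if \<open>t\<close> anticommutes with \<open>s\<close>, then \<open>x = (1 + t) s (1 + t)\<^sup>-\<^sup>1\<close> is an imaginary unit.
  Both transforms are defined on open subsets of the whole algebra, so they form a slice chart with
  model the anticommutant of \<open>s\<close>, which is also the tangent space at \<open>s\<close>, and left multiplication by
  \<open>s\<close> turns it into a holomorphic chart. On the side of the Grassmannian, \<open>\<W> L\<^sub>x\<close> is the graph of the map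
  \<open>(v, s v) \<mapsto> (t v, - s t v)\<close> from \<open>\<W> L\<^sub>s\<close> to the complementary eigenspace. Hence in the affine chart
  given by these two eigenspaces, the image of the units is flat and the map \<open>x \<mapsto> \<W> L\<^sub>x\<close> is linear.\<close>

section \<open>Calculus\<close>

text \<open>The transform is read off from the eigenspaces: in the splitting for s, the vector (v, x
  v) has components (a, s a) and (b, - s b) with a = (v - s x v) / 2 and b = (v + s x v) / 2, and b
  = t a for all v means t (1 - s x) = 1 + s x. Anticommutation of t and s then expresses complex
  linearity of the graph map. Two obstacles shape the proof. The affine chart given by the two
  eigenspaces must be cut down: every t in the anticommutant gives a point of it, but this is some
  \<W> L_x only if 1 + t is invertible. Being complementary to {0} \<times> UNIV is the open
  condition that singles out these t. Moreover, \<open>holomorphic_charts\<close> and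
  \<open>submanifold_atlas\<close> contain all admissible charts, so holomorphy is needed for every
  pair of them. Each pair is factored through the two special charts at a point. Models are
  subspaces of larger spaces, and derivatives are determined only along them; this is the source of
  the closedness conditions.\<close>

lemma Ck_on_cong:
  assumes "open U" "\<And>x. x \<in> U \<Longrightarrow> f x = g x" "Ck_on k U f"
  shows "Ck_on k U g"
  using assms(2,3)
proof (induction k arbitrary: f g)
  case 0
  then show ?case
    by (auto cong: continuous_on_cong)
next
  case (Suc k)
  have "g differentiable (at x)" if "x \<in> U" for x
    using Suc.prems(2) that has_derivative_transform_within_open[OF _ assms(1) that, of f _ UNIV g] Suc.prems(1)
    unfolding differentiable_def by (metis Ck_on.simps(2) differentiable_def)
  moreover have "Ck_on k U (\<lambda>x. frechet_derivative g (at x) v)" for v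
  proof (rule Suc.IH)
    show "frechet_derivative f (at x) v = frechet_derivative g (at x) v" if "x \<in> U" for x
      using frechet_derivative_transform_within_open[of f x U g] that Suc.prems assms(1) by simp
  qed (use Suc.prems in simp)
  ultimately show ?case
    by simp
qed

text \<open>Openness of \<open>U\<close> turns agreement on \<open>U\<close> into agreement near
  each point, so an explicit formula for the derivative may stand in for
  \<open>frechet_derivative\<close>, which is defined by choice.\<close>

lemma Ck_on_SucI:
  assumes "open U" "\<And>x. x \<in> U \<Longrightarrow> (f has_derivative D x) (at x)" "\<And>v. Ck_on k U (\<lambda>x. D x v)"
  shows "Ck_on (Suc k) U f"
proof -
  have "Ck_on k U (\<lambda>x. frechet_derivative f (at x) v)" for v
    using assms(1) _ assms(3)
    by (rule Ck_on_cong) (simp add: frechet_derivative_at[OF assms(2), symmetric])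
  then show ?thesis
    using assms(2) by (auto simp: differentiable_def)
qed

lemma Ck_on_SucD:
  assumes "Ck_on (Suc k) U f"
  shows "Ck_on k U f"
  using assms
proof (induction k arbitrary: f)
  case 0
  then show ?case
    by (auto intro!: continuous_at_imp_continuous_on differentiable_imp_continuous_within)
next
  case (Suc k)
  then show ?case
    by (metis Ck_on.simps(2))
qed

lemma Ck_on_has_derivative:
  assumes "Ck_on (Suc k) U f" "x \<in> U"
  shows "(f has_derivative frechet_derivative f (at x)) (at x)"
  using assms frechet_derivative_works by auto

lemma Ck_on_const: "open U \<Longrightarrow> Ck_on k U (\<lambda>x. c)"
proof (induction k arbitrary: c)
  case (Suc k)
  show ?case
    by (rule Ck_on_SucI[where D = "\<lambda>_ _. 0"]) (use Suc in auto)
qed auto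

lemma Ck_on_bounded_linear:
  assumes "bounded_linear f" "open U"
  shows "Ck_on k U f"
proof (cases k)
  case 0
  then show ?thesis
    using assms by (simp add: linear_continuous_on)
next
  case (Suc m)
  show ?thesis unfolding Suc
    by (rule Ck_on_SucI[where D = "\<lambda>_. f"])
      (use assms Ck_on_const in \<open>auto intro: bounded_linear_imp_has_derivative\<close>)
qed

lemma Ck_on_add:
  assumes "open U" "Ck_on k U f" "Ck_on k U g"
  shows "Ck_on k U (\<lambda>x. f x + g x)"
  using assms(2,3)
proof (induction k arbitrary: f g)
  case (Suc k)
  show ?case
  proof (rule Ck_on_SucI[OF assms(1)])
    show "((\<lambda>x. f x + g x) has_derivative
        (\<lambda>v. frechet_derivative f (at x) v + frechet_derivative g (at x) v)) (at x)"
      if "x \<in> U" for x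
      using Suc.prems that by (intro has_derivative_add Ck_on_has_derivative)
  qed (use Suc in simp)
qed (auto intro: continuous_on_add)

lemma Ck_on_prod:
  assumes "bounded_bilinear mul" "open U" "Ck_on k U f" "Ck_on k U g"
  shows "Ck_on k U (\<lambda>x. mul (f x) (g x))"
  using assms(3,4)
proof (induction k arbitrary: f g)
  case 0
  then show ?case
    using bounded_bilinear.continuous_on[OF assms(1)] by simp
next
  case (Suc k)
  show ?case
  proof (rule Ck_on_SucI[OF assms(2)])
    show "((\<lambda>x. mul (f x) (g x)) has_derivative
        (\<lambda>v. mul (f x) (frechet_derivative g (at x) v) + mul (frechet_derivative f (at x) v) (g x)))
        (at x)" if "x \<in> U" for x
      using Suc.prems that by (intro bounded_bilinear.FDERIV[OF assms(1)] Ck_on_has_derivative)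
    show "Ck_on k U (\<lambda>x. mul (f x) (frechet_derivative g (at x) v) +
        mul (frechet_derivative f (at x) v) (g x))" for v
      using Suc.prems by (intro Ck_on_add[OF assms(2)] Suc.IH) (auto intro: Ck_on_SucD)
  qed
qed

section \<open>Smooth maps on arbitrary subsets, and differentiability from quadratic
  estimates\<close>

lemma smooth_onI:
  assumes "open U" "X \<subseteq> U" "\<And>k. Ck_on k U f"
  shows "smooth_on X f"
  using assms by (auto simp: smooth_on_def)

lemma smooth_on_subset:
  assumes "smooth_on X f" "Y \<subseteq> X"
  shows "smooth_on Y f"
  unfolding smooth_on_def
proof
  fix p assume "p \<in> Y"
  with assms(2) have "p \<in> X"
    by blast
  from bspec[OF assms(1)[unfolded smooth_on_def] this]
  obtain U g where "open U" "p \<in> U" "\<forall>k. Ck_on k U g" "\<forall>x\<in>X \<inter> U. g x = f x"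
    by auto
  then show "\<exists>U g. open U \<and> p \<in> U \<and> (\<forall>k. Ck_on k U g) \<and> (\<forall>x\<in>Y \<inter> U. g x = f x)"
    using assms(2) by (intro exI[of _ U] exI[of _ g]) auto
qed

lemma smooth_on_has_derivative:
  assumes "smooth_on X f" "x \<in> X"
  obtains D where "(f has_derivative D) (at x within X)"
proof -
  obtain U g where g: "open U" "x \<in> U" "\<And>k. Ck_on k U g" "\<forall>y\<in>X \<inter> U. g y = f y"
    using assms unfolding smooth_on_def by blast
  have "(g has_derivative frechet_derivative g (at x)) (at x within X)"
    using Ck_on_has_derivative[OF g(3,2)] by (rule has_derivative_at_withinI)
  moreover obtain e where "e > 0" "ball x e \<subseteq> U"
    using g(1,2) openE by blast
  ultimately have "(f has_derivative frechet_derivative g (at x)) (at x within X)"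
    using assms(2) g(4) by (elim has_derivative_transform_within) (auto simp: subset_iff dist_commute)
  then show ?thesis
    using that by blast
qed

lemma has_derivative_quadratic:
  assumes "bounded_linear D" "\<epsilon> > 0"
    and le: "\<And>y. y \<in> X \<Longrightarrow> norm (y - x) < \<epsilon> \<Longrightarrow> norm (f y - f x - D (y - x)) \<le> C * (norm (y - x))\<^sup>2"
  shows "(f has_derivative D) (at x within X)"
  unfolding has_derivative_within_alt
proof (intro conjI allI impI assms(1))
  fix e :: real assume "e > 0"
  \<comment> \<open>Below this radius one factor of the quadratic bound is absorbed into
    \<open>e\<close>. As \<open>C\<close> may be zero or negative, the denominator is
    \<open>\<bar>C\<bar> + 1\<close>.\<close>
  define d where "d = min \<epsilon> (e / (\<bar>C\<bar> + 1))"
  have "norm (f y - f x - D (y - x)) \<le> e * norm (y - x)" if y: "y \<in> X" "norm (y - x) < d" for y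
  proof -
    have "norm (y - x) * (\<bar>C\<bar> + 1) \<le> e"
      using y(2) unfolding d_def by (simp add: pos_less_divide_eq less_imp_le)
    moreover have "C * norm (y - x) \<le> norm (y - x) * (\<bar>C\<bar> + 1)"
      by (simp add: mult.commute mult_right_mono)
    ultimately have "C * norm (y - x) * norm (y - x) \<le> e * norm (y - x)"
      by (intro mult_right_mono) auto
    then show ?thesis
      using le[OF y(1)] y(2) by (simp add: d_def power2_eq_square algebra_simps)
  qed
  moreover have "d > 0"
    using \<open>e > 0\<close> \<open>\<epsilon> > 0\<close> by (simp add: d_def)
  ultimately show "\<exists>d>0. \<forall>y\<in>X. norm (y - x) < d \<longrightarrow> norm (f y - f x - D (y - x)) \<le> e * norm (y - x)"
    by blast
qed

lemma contraction_zero: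
  fixes x :: "'a::real_normed_vector"
  assumes "c < 1" "norm x \<le> c * norm x"
  shows "x = 0"
proof (rule ccontr)
  assume "x \<noteq> 0"
  then have "c * norm x < 1 * norm x"
    using assms(1) by (intro mult_strict_right_mono) auto
  with assms(2) show False
    by simp
qed

lemma bounded_bilinear_times:
  "bounded_bilinear ((*) :: 'a::{real_algebra_1, euclidean_space} \<Rightarrow> 'a \<Rightarrow> 'a)"
  unfolding bilinear_conv_bounded_bilinear[symmetric] bilinear_def
  by (auto intro!: linearI simp: algebra_simps)

section \<open>Inversion in a finite-dimensional algebra\<close>

definition invertibles :: "'a::monoid_mult set" where
  "invertibles = {a. \<exists>b. a * b = 1 \<and> b * a = 1}"

definition minv :: "'a::monoid_mult \<Rightarrow> 'a" where
  "minv a = (THE b. a * b = 1 \<and> b * a = 1)"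

lemma minv_eqI:
  assumes "a * b = 1" "b * a = 1"
  shows "minv a = b"
  unfolding minv_def
proof (rule the_equality)
  show "c = b" if "a * c = 1 \<and> c * a = 1" for c
    using that assms by (metis mult.assoc mult_1_left mult_1_right)
qed (use assms in simp)

lemma invertiblesI: "a * b = 1 \<Longrightarrow> b * a = 1 \<Longrightarrow> a \<in> invertibles"
  by (auto simp: invertibles_def)

lemma minv:
  assumes "a \<in> invertibles"
  shows right_minv: "a * minv a = 1" and left_minv: "minv a * a = 1"
proof -
  obtain b where "a * b = 1" "b * a = 1"
    using assms by (auto simp: invertibles_def)
  then show "a * minv a = 1" "minv a * a = 1"
    using minv_eqI by metis+
qed

lemma minv_cancel:
  assumes "a \<in> invertibles"
  shows "a * (minv a * x) = x" "minv a * (a * x) = x" "x * a * minv a = x" "x * minv a * a = x"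
  using minv[OF assms] by (metis mult.assoc mult_1_left mult_1_right)+

lemma linear_times:
  "linear (\<lambda>x. a * x :: 'a::{real_algebra_1, euclidean_space})"
  by (auto intro!: linearI simp: algebra_simps)

text \<open>In finite dimension an injective left multiplication is onto, which yields
  \<open>b\<close> with a b = 1; then a (b a) = a, and injectivity gives b a = 1.\<close>

lemma invertibles_if_inj:
  fixes a :: "'a::{real_algebra_1, euclidean_space}"
  assumes "\<And>x. a * x = 0 \<Longrightarrow> x = 0"
  shows "a \<in> invertibles"
proof -
  have "inj ((*) a)"
    using linear_injective_0[OF linear_times[of a]] assms by auto
  moreover from this obtain b where "a * b = 1"
    using linear_inj_imp_surj[OF linear_times] by (metis surjD)
  moreover from this have "a * (b * a) = a * 1"
    by (simp flip: mult.assoc)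
  ultimately show ?thesis
    by (metis inj_eq invertiblesI)
qed

text \<open>From y x = 0 follows x = a^-1 (a - y) x. For \<open>y\<close> close to \<open>a\<close>
  the right-hand side is a contraction applied to \<open>x\<close>, so x = 0 and left multiplication
  by \<open>y\<close> is injective.\<close>

lemma open_invertibles: "open (invertibles :: 'a::{real_algebra_1, euclidean_space} set)"
  unfolding open_dist
proof
  fix a :: 'a assume a: "a \<in> invertibles"
  obtain K where K: "K > 0" "\<And>x y :: 'a. norm (x * y) \<le> norm x * norm y * K"
    using bounded_bilinear.pos_bounded[OF bounded_bilinear_times] by blast
  \<comment> \<open>The norm is not assumed submultiplicative, hence a factor \<open>K\<close> for
    each of the two products; adding 1 makes positivity of the denominator immediate.\<close>
  define e where "e = 1 / (K * K * (norm (minv a) + 1))"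
  have "e > 0"
    unfolding e_def using K by (simp add: add_nonneg_pos)
  moreover have "y \<in> invertibles" if y: "dist y a < e" for y
  proof (rule invertibles_if_inj)
    fix x assume "y * x = 0"
    then have "x = minv a * ((a - y) * x)"
      using minv_cancel(2)[OF a] by (simp add: algebra_simps)
    then have "norm x \<le> norm (minv a) * norm ((a - y) * x) * K"
      using K(2) by metis
    also have "\<dots> \<le> norm (minv a) * (norm (a - y) * norm x * K) * K"
      using K by (intro mult_right_mono mult_left_mono) auto
    also have "\<dots> = (norm (a - y) * (K * K * norm (minv a))) * norm x"
      by (simp add: algebra_simps)
    finally have le: "norm x \<le> (norm (a - y) * (K * K * norm (minv a))) * norm x" .
    have "norm (a - y) * (K * K * (norm (minv a) + 1)) < 1"
      using y K unfolding e_def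
      by (simp add: dist_norm norm_minus_commute pos_less_divide_eq add_nonneg_pos)
    moreover have "norm (a - y) * (K * K * norm (minv a)) \<le> norm (a - y) * (K * K * (norm (minv a) + 1))"
      using K by (intro mult_left_mono) auto
    ultimately have "norm (a - y) * (K * K * norm (minv a)) < 1"
      by linarith
    then show "x = 0"
      using le by (rule contraction_zero)
  qed
  ultimately show "\<exists>e>0. \<forall>y. dist y a < e \<longrightarrow> y \<in> invertibles"
    by blast
qed

text \<open>The resolvent identity y^-1 - a^-1 = - y^-1 (y - a) a^-1 is used twice. It first bounds
  y^-1 near a, hence the difference of inverses by a multiple of norm (y - a); it then exhibits the
  remainder as the product of that difference with y - a and a^-1, which is of second order.\<close>

lemma has_derivative_minv:
  fixes a :: "'a::{real_algebra_1, euclidean_space}"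
  assumes a: "a \<in> invertibles"
  shows "(minv has_derivative (\<lambda>h. - (minv a * h * minv a))) (at a)"
proof -
  let ?b = "minv a"
  obtain K where K: "K > 0" "\<And>x y :: 'a. norm (x * y) \<le> norm x * norm y * K"
    using bounded_bilinear.pos_bounded[OF bounded_bilinear_times] by blast
  have K3: "norm (x * y * z) \<le> norm x * norm y * norm z * K\<^sup>2" for x y z :: 'a
  proof -
    have "norm (x * y * z) \<le> norm (x * y) * norm z * K"
      by (rule K)
    also have "\<dots> \<le> (norm x * norm y * K) * norm z * K"
      using K by (intro mult_right_mono) auto
    finally show ?thesis
      by (simp add: power2_eq_square algebra_simps)
  qed
  have diff: "minv y - ?b = - (minv y * (y - a) * ?b)" if "y \<in> invertibles" for y
    by (simp add: left_diff_distrib right_diff_distrib minv_cancel[OF that] minv_cancel[OF a]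
        minv[OF that] mult.assoc right_minv[OF a])
  \<comment> \<open>This radius makes norm (y - a) * norm b * K^2 at most 1/2 for b = a^-1, so the
    term with y^-1 can be absorbed, which gives norm (y^-1) \<le> 2 * norm b.\<close>
  define e where "e = 1 / (2 * K\<^sup>2 * (norm ?b + 1))"
  have bound: "norm (minv y - ?b) \<le> 2 * (norm ?b)\<^sup>2 * K\<^sup>2 * norm (y - a)"
    if y: "y \<in> invertibles" "norm (y - a) < e" for y
  proof -
    have "norm (y - a) * (2 * K\<^sup>2 * (norm ?b + 1)) < 1"
      using y K unfolding e_def by (simp add: pos_less_divide_eq add_nonneg_pos)
    moreover have "norm (y - a) * (2 * K\<^sup>2 * norm ?b) \<le> norm (y - a) * (2 * K\<^sup>2 * (norm ?b + 1))"
      using K by (intro mult_left_mono) auto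
    ultimately have "norm (y - a) * (2 * K\<^sup>2 * norm ?b) \<le> 1"
      by linarith
    then have half: "norm (y - a) * norm ?b * K\<^sup>2 \<le> 1 / 2"
      by (simp add: algebra_simps)
    have d: "norm (minv y - ?b) \<le> norm (minv y) * norm (y - a) * norm ?b * K\<^sup>2"
      unfolding diff[OF y(1)] using K3 by simp
    also have "\<dots> \<le> norm (minv y) * (1 / 2)"
      using half by (simp only: mult.assoc mult_left_mono norm_ge_zero)
    finally have "norm (minv y) \<le> 2 * norm ?b"
      using norm_triangle_sub[of "minv y" ?b] by linarith
    then have "norm (minv y) * (norm (y - a) * norm ?b * K\<^sup>2) \<le>
        2 * norm ?b * (norm (y - a) * norm ?b * K\<^sup>2)"
      by (intro mult_right_mono) auto
    with d show ?thesis
      by (simp add: power2_eq_square algebra_simps)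
  qed
  obtain r where r: "r > 0" "ball a r \<subseteq> invertibles"
    using open_invertibles a openE by blast
  show ?thesis
  \<comment> \<open>The constant is the product of 2 * norm b ^ 2 * K ^ 2 from \<open>bound\<close>
    and of norm b * K ^ 2 from the two further products, where b = a^-1.\<close>
  proof (rule has_derivative_quadratic[where \<epsilon> = "min e r" and X = UNIV and C = "2 * norm ?b ^ 3 * K ^ 4"])
    show "bounded_linear (\<lambda>h. - (?b * h * ?b))"
      by (auto intro!: linearI simp: algebra_simps simp flip: linear_conv_bounded_linear)
    show "0 < min e r"
      unfolding e_def using K r by (simp add: add_nonneg_pos)
    fix y assume y: "norm (y - a) < min e r"
    then have inv: "y \<in> invertibles"
      using r by (auto simp: dist_norm norm_minus_commute subset_iff)
    have "minv y - ?b - - (?b * (y - a) * ?b) = - ((minv y - ?b) * (y - a) * ?b)"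
      by (subst diff[OF inv]) (simp add: algebra_simps)
    then have "norm (minv y - ?b - - (?b * (y - a) * ?b)) \<le>
        norm (minv y - ?b) * (norm (y - a) * norm ?b * K\<^sup>2)"
      using K3 by (simp add: mult.assoc)
    also have "\<dots> \<le> 2 * (norm ?b)\<^sup>2 * K\<^sup>2 * norm (y - a) * (norm (y - a) * norm ?b * K\<^sup>2)"
      using bound[OF inv] y by (intro mult_right_mono) auto
    finally show "norm (minv y - ?b - - (?b * (y - a) * ?b)) \<le>
        2 * norm ?b ^ 3 * K ^ 4 * (norm (y - a))\<^sup>2"
      by (simp add: eval_nat_numeral algebra_simps)
  qed
qed

text \<open>The derivative of the inverse is built from the inverse itself, so order k for the
  inverse and order k + 1 for \<open>f\<close> bootstrap to order k + 1.\<close>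

lemma Ck_on_minv:
  fixes f :: "'b::euclidean_space \<Rightarrow> 'a::{real_algebra_1, euclidean_space}"
  assumes "open U" "f ` U \<subseteq> invertibles" "Ck_on k U f"
  shows "Ck_on k U (\<lambda>x. minv (f x))"
  using assms(3)
proof (induction k)
  case 0
  have "isCont minv (f x)" if "x \<in> U" for x
    using has_derivative_minv[of "f x"] assms(2) that has_derivative_continuous by blast
  then have "continuous_on (f ` U) minv"
    by (intro continuous_at_imp_continuous_on) auto
  with 0 show ?case
    by (auto intro: continuous_on_compose2)
next
  case (Suc k)
  note prod = Ck_on_prod[OF bounded_bilinear_times assms(1)]
  have IH: "Ck_on k U (\<lambda>x. minv (f x))"
    using Suc Ck_on_SucD by blast
  show ?case
  proof (rule Ck_on_SucI[OF assms(1)])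
    show "((\<lambda>x. minv (f x)) has_derivative
        (\<lambda>v. (- 1) * (minv (f x) * frechet_derivative f (at x) v * minv (f x)))) (at x)"
      if "x \<in> U" for x
      using has_derivative_compose[OF Ck_on_has_derivative[OF Suc.prems that] has_derivative_minv[of "f x"]]
        assms(2) that by (simp add: image_subset_iff)
    show "Ck_on k U (\<lambda>x. (- 1) * (minv (f x) * frechet_derivative f (at x) v * minv (f x)))" for v
      using Suc.prems by (intro prod IH Ck_on_const assms(1)) simp
  qed
qed

section \<open>The Cayley transform\<close>

text \<open>The kernel of h |-> s h + h s, the differential at \<open>s\<close> of the squaring
  map.\<close>

definition anticommutant :: "'a::ring \<Rightarrow> 'a set" where
  "anticommutant s = {h. s * h + h * s = 0}"

definition cayley :: "'a::ring_1 \<Rightarrow> 'a \<Rightarrow> 'a" where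
  "cayley s x = (1 + s * x) * minv (1 - s * x)"

definition cayley_inv :: "'a::ring_1 \<Rightarrow> 'a \<Rightarrow> 'a" where
  "cayley_inv s t = s * (1 - t) * minv (1 + t)"

definition cayley_dom :: "'a::ring_1 \<Rightarrow> 'a set" where
  "cayley_dom s = {x. 1 - s * x \<in> invertibles}"

definition cayley_ran :: "'a::ring_1 set" where
  "cayley_ran = {t. 1 + t \<in> invertibles}"

lemma imaginary_units_iff: "s \<in> imaginary_units \<longleftrightarrow> s * s = - 1"
  by (simp add: imaginary_units_def power2_eq_square)

lemma imaginary_unit_cancel:
  assumes "s \<in> imaginary_units"
  shows "s * s = - 1" "s * (s * x) = - x" "x * s * s = - x"
  using assms by (simp_all add: imaginary_units_iff mult.assoc) (simp flip: mult.assoc)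

lemma uminus_imaginary_units [simp]: "- s \<in> imaginary_units \<longleftrightarrow> s \<in> imaginary_units"
  by (simp add: imaginary_units_iff)

lemma anticommutantD: "h \<in> anticommutant s \<Longrightarrow> h * s = - (s * h)"
  by (simp add: anticommutant_def add_eq_0_iff)

lemma anticommutantI: "h * s = - (s * h) \<Longrightarrow> h \<in> anticommutant s"
  by (simp add: anticommutant_def)

lemma subspace_anticommutant:
  "subspace (anticommutant s :: 'a::real_algebra_1 set)"
  by (rule subspaceI) (auto simp: anticommutant_def algebra_simps add_eq_0_iff)

lemma times_anticommutant:
  assumes "s \<in> imaginary_units" "h \<in> anticommutant s"
  shows "s * h \<in> anticommutant s"
  using anticommutantD[OF assms(2)] by (intro anticommutantI) (simp add: mult.assoc)

lemma complex_structure_anticommutant: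
  fixes s :: "'a::real_algebra_1"
  assumes "s \<in> imaginary_units"
  shows "complex_structure_on (anticommutant s) ((*) s)"
  unfolding complex_structure_on_def
  using subspace_anticommutant times_anticommutant[OF assms]
  by (auto simp: distrib_left imaginary_unit_cancel[OF assms])

context
  fixes s :: "'a::{real_algebra_1, euclidean_space}"
  assumes s: "s \<in> imaginary_units"
begin

lemma cayley_dom_self: "s \<in> cayley_dom s"
proof -
  have "(1 - s * s) * ((1 / 2) *\<^sub>R 1) = 1" "((1 / 2) *\<^sub>R 1) * (1 - s * s) = 1"
    by (simp_all add: imaginary_unit_cancel[OF s] flip: scaleR_2)
  then show ?thesis
    unfolding cayley_dom_def by (blast intro: invertiblesI)
qed

text \<open>With b = (1 - s x)^-1 the transform equals 2 b - 1, so 1 + t = 2 b has inverse (1 - s x)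
  / 2; substituting this into \<open>cayley_inv\<close> gives back s (- s x) = x.\<close>

lemma
  assumes x: "x \<in> cayley_dom s"
  shows cayley_in_ran: "cayley s x \<in> cayley_ran"
    and cayley_inv_cayley: "cayley_inv s (cayley s x) = x"
proof -
  define b where "b = minv (1 - s * x)"
  have b: "(1 - s * x) * b = 1" "b * (1 - s * x) = 1"
    using x minv unfolding cayley_dom_def b_def by blast+
  have bx: "s * x * b = b - 1" "b * (s * x) = b - 1"
    using b by (simp_all add: algebra_simps)
  have t: "cayley s x = 2 *\<^sub>R b - 1"
    using bx by (simp add: cayley_def b_def[symmetric] distrib_right scaleR_2)
  have *: "(1 + cayley s x) * ((1 / 2) *\<^sub>R (1 - s * x)) = 1"
    "((1 / 2) *\<^sub>R (1 - s * x)) * (1 + cayley s x) = 1"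
    unfolding t using b by simp_all
  show "cayley s x \<in> cayley_ran"
    unfolding cayley_ran_def using invertiblesI[OF *] by simp
  have two: "1 - (2 *\<^sub>R b - 1) = 2 *\<^sub>R (1 - b)"
    unfolding scaleR_2 by (simp add: algebra_simps)
  have "cayley_inv s (cayley s x) = s * ((2 *\<^sub>R (1 - b)) * ((1 / 2) *\<^sub>R (1 - s * x)))"
    unfolding cayley_inv_def minv_eqI[OF *] unfolding t two by (simp only: mult.assoc)
  also have "\<dots> = s * ((1 - s * x) - b * (1 - s * x))"
    by (simp add: left_diff_distrib)
  also have "\<dots> = x"
    unfolding b by (simp add: imaginary_unit_cancel[OF s])
  finally show "cayley_inv s (cayley s x) = x" .
qed

text \<open>Dually, with c = (1 + t)^-1 and x = \<open>cayley_inv s t\<close> one has s x = 1 - 2 c,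
  so 1 - s x = 2 c has inverse (1 + t) / 2.\<close>

lemma
  assumes t: "t \<in> cayley_ran"
  shows cayley_inv_in_dom: "cayley_inv s t \<in> cayley_dom s"
    and cayley_cayley_inv: "cayley s (cayley_inv s t) = t"
proof -
  define c where "c = minv (1 + t)"
  have c: "(1 + t) * c = 1" "c * (1 + t) = 1"
    using t minv unfolding cayley_ran_def c_def by blast+
  have tc: "t * c = 1 - c"
    using c by (simp add: algebra_simps)
  have sx: "s * cayley_inv s t = 1 - 2 *\<^sub>R c"
    using tc by (simp add: cayley_inv_def mult.assoc imaginary_unit_cancel[OF s] left_diff_distrib
        c_def[symmetric] scaleR_2)
  have *: "(1 - s * cayley_inv s t) * ((1 / 2) *\<^sub>R (1 + t)) = 1"
    "((1 / 2) *\<^sub>R (1 + t)) * (1 - s * cayley_inv s t) = 1"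
    unfolding sx using c by simp_all
  show "cayley_inv s t \<in> cayley_dom s"
    unfolding cayley_dom_def using invertiblesI[OF *] by simp
  have two: "1 + (1 - 2 *\<^sub>R c) = 2 *\<^sub>R (1 - c)"
    unfolding scaleR_2 by (simp add: algebra_simps)
  have "cayley s (cayley_inv s t) = (2 *\<^sub>R (1 - c)) * ((1 / 2) *\<^sub>R (1 + t))"
    unfolding cayley_def minv_eqI[OF *] unfolding sx two ..
  also have "\<dots> = t"
    using c by (simp add: left_diff_distrib)
  finally show "cayley s (cayley_inv s t) = t" .
qed

text \<open>As x x = s s = -1, one has (1 - s x) x = x + s = s (1 - s x) and (1 + s x) x = x - s.
  Hence t s (1 - s x) = x - s = - s t (1 - s x), and the invertible factor cancels.\<close>

lemma cayley_anticommutant: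
  assumes x: "x \<in> cayley_dom s" "x \<in> imaginary_units"
  shows "cayley s x \<in> anticommutant s"
proof (rule anticommutantI)
  let ?t = "cayley s x"
  have inv: "1 - s * x \<in> invertibles"
    using x by (simp add: cayley_dom_def)
  have t: "?t * (1 - s * x) = 1 + s * x"
    by (simp add: cayley_def minv_cancel[OF inv])
  have "?t * (s + x) = ?t * (1 - s * x) * x"
    by (simp add: mult.assoc left_diff_distrib imaginary_unit_cancel[OF x(2)] add.commute)
  also have "\<dots> = x - s"
    unfolding t by (simp add: mult.assoc distrib_right imaginary_unit_cancel[OF x(2)])
  finally have "?t * s * (1 - s * x) = - (s * (?t * (1 - s * x)))"
    unfolding t by (simp add: algebra_simps imaginary_unit_cancel[OF s])
  then have "?t * s * (1 - s * x) * minv (1 - s * x) = - (s * ?t) * (1 - s * x) * minv (1 - s * x)"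
    by (simp add: mult.assoc)
  then show "?t * s = - (s * ?t)"
    by (simp only: minv_cancel[OF inv])
qed

text \<open>Anticommutation says (1 + t) s = s (1 - t), so \<open>cayley_inv s t\<close> is the
  conjugate of \<open>s\<close> by 1 + t and inherits the square -1.\<close>

lemma cayley_inv_intertwines:
  assumes "t \<in> cayley_ran" "t \<in> anticommutant s"
  shows "cayley_inv s t * (1 + t) = s * (1 - t)" "cayley_inv s t * (1 + t) = (1 + t) * s"
  using assms anticommutantD[OF assms(2)]
  by (simp_all add: cayley_inv_def cayley_ran_def minv_cancel right_diff_distrib distrib_right)

lemma cayley_inv_imaginary_unit:
  assumes t: "t \<in> cayley_ran" "t \<in> anticommutant s"
  shows "cayley_inv s t \<in> imaginary_units"
proof -
  let ?x = "cayley_inv s t"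
  have inv: "1 + t \<in> invertibles"
    using t by (simp add: cayley_ran_def)
  have "?x * ?x * (1 + t) * minv (1 + t) = - (1 + t) * minv (1 + t)"
    by (simp add: mult.assoc cayley_inv_intertwines(2)[OF t])
      (simp add: cayley_inv_intertwines(2)[OF t] imaginary_unit_cancel[OF s] flip: mult.assoc)
  then have "?x * ?x = - 1"
    by (simp only: minv_cancel[OF inv] mult_minus_left right_minv[OF inv])
  then show ?thesis
    by (simp add: imaginary_units_iff)
qed

lemma cayley_image_units:
  "cayley s ` (cayley_dom s \<inter> imaginary_units) = cayley_ran \<inter> anticommutant s"
  using cayley_in_ran cayley_anticommutant cayley_inv_in_dom cayley_inv_imaginary_unit
    cayley_cayley_inv by (force simp: image_iff)

lemma open_cayley_dom: "open (cayley_dom s)"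
proof -
  have "continuous_on UNIV (\<lambda>x. 1 - s * x)"
    by (intro continuous_intros linear_continuous_on bounded_bilinear.bounded_linear_right[OF bounded_bilinear_times])
  then show ?thesis
    unfolding cayley_dom_def using open_vimage[OF open_invertibles] by (simp add: vimage_def)
qed

lemma open_cayley_ran: "open (cayley_ran :: 'a set)"
proof -
  have "continuous_on UNIV (\<lambda>x :: 'a. 1 + x)"
    by (intro continuous_intros)
  then show ?thesis
    unfolding cayley_ran_def using open_vimage[OF open_invertibles] by (simp add: vimage_def)
qed

lemma Ck_on_cayley: "Ck_on k (cayley_dom s) (cayley s)"
proof -
  note prod = Ck_on_prod[OF bounded_bilinear_times]
  have sx: "Ck_on k (cayley_dom s) (\<lambda>x. s * x)"
    by (intro prod Ck_on_const Ck_on_bounded_linear[OF bounded_linear_ident] open_cayley_dom)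
  have "Ck_on k (cayley_dom s) (\<lambda>x. 1 + (- 1) * (s * x))"
    by (intro prod Ck_on_add Ck_on_const open_cayley_dom sx)
  then have "Ck_on k (cayley_dom s) (\<lambda>x. (1 + s * x) * minv (1 - s * x))"
    by (intro prod Ck_on_add Ck_on_minv Ck_on_const open_cayley_dom sx) (auto simp: cayley_dom_def)
  then show ?thesis
    by (simp add: cayley_def[abs_def])
qed

lemma Ck_on_cayley_inv: "Ck_on k cayley_ran (cayley_inv s)"
proof -
  note prod = Ck_on_prod[OF bounded_bilinear_times]
  have "Ck_on k cayley_ran (\<lambda>x. s * (1 + (- 1) * x) * minv (1 + x))"
    by (intro prod Ck_on_add Ck_on_minv Ck_on_const Ck_on_bounded_linear[OF bounded_linear_ident]
        open_cayley_ran) (auto simp: cayley_ran_def)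
  then show ?thesis
    by (simp add: cayley_inv_def[abs_def])
qed

lemma diffeomorphism_cayley: "diffeomorphism (cayley_dom s) cayley_ran (cayley s) (cayley_inv s)"
proof -
  have "homeomorphism (cayley_dom s) cayley_ran (cayley s) (cayley_inv s)"
    using Ck_on_cayley[of 0] Ck_on_cayley_inv[of 0]
    by (intro homeomorphismI) (auto intro: cayley_in_ran cayley_inv_in_dom cayley_inv_cayley cayley_cayley_inv)
  moreover have "smooth_on (cayley_dom s) (cayley s)" "smooth_on cayley_ran (cayley_inv s)"
    using smooth_onI[OF open_cayley_dom _ Ck_on_cayley] smooth_onI[OF open_cayley_ran _ Ck_on_cayley_inv]
    by auto
  ultimately show ?thesis
    by (simp add: diffeomorphism_def)
qed

text \<open>With b = (1 - s x)^-1 the product rule gives s h b + (1 + s x) b s h b, and (1 + s x) b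
  is the transform itself.\<close>

lemma has_derivative_cayley:
  assumes "x \<in> cayley_dom s"
  shows "(cayley s has_derivative (\<lambda>h. (1 + cayley s x) * (s * h) * minv (1 - s * x))) (at x)"
proof -
  let ?b = "minv (1 - s * x)"
  have inv: "1 - s * x \<in> invertibles"
    using assms by (simp add: cayley_dom_def)
  have l: "((\<lambda>x. s * x) has_derivative (\<lambda>h. s * h)) (at x)"
    by (intro bounded_linear_imp_has_derivative bounded_bilinear.bounded_linear_right[OF bounded_bilinear_times])
  have "((\<lambda>x. 1 - s * x) has_derivative (\<lambda>h. 0 - s * h)) (at x)"
    by (intro has_derivative_diff has_derivative_const l)
  from has_derivative_compose[OF this has_derivative_minv[OF inv]]
  have m: "((\<lambda>x. minv (1 - s * x)) has_derivative (\<lambda>h. ?b * (s * h) * ?b)) (at x)"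
    by simp
  have "((\<lambda>x. 1 + s * x) has_derivative (\<lambda>h. 0 + s * h)) (at x)"
    by (intro has_derivative_add has_derivative_const l)
  from bounded_bilinear.FDERIV[OF bounded_bilinear_times this m]
  show ?thesis
    unfolding cayley_def[abs_def] by (rule has_derivative_eq_rhs) (simp add: cayley_def algebra_simps)
qed

end

section \<open>The imaginary units as a submanifold\<close>

lemma smooth_submanifold_imaginary_units:
  "smooth_submanifold (imaginary_units :: 'a::{real_algebra_1, euclidean_space} set)"
  unfolding smooth_submanifold_def
proof
  fix s :: 'a assume s: "s \<in> imaginary_units"
  show "\<exists>U (V :: 'a set) \<Phi> \<Psi> E. open U \<and> s \<in> U \<and> open V \<and> diffeomorphism U V \<Phi> \<Psi> \<and> subspace E \<and>
      \<Phi> ` (U \<inter> imaginary_units) = V \<inter> E"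
    using open_cayley_dom[OF s] cayley_dom_self[OF s] open_cayley_ran[OF s] diffeomorphism_cayley[OF s]
      subspace_anticommutant cayley_image_units[OF s] by blast
qed

text \<open>Both factors are expanded in the orthonormal basis; the coefficients are the structure
  constants \<open>(i * j) \<bullet> b\<close> of the algebra.\<close>

lemma real_polynomial_function_times:
  fixes b :: "'a::{real_algebra_1, euclidean_space}"
  shows "real_polynomial_function (\<lambda>x. (x * x) \<bullet> b)"
proof -
  have "(x * x) \<bullet> b = (\<Sum>i\<in>Basis. \<Sum>j\<in>Basis. (x \<bullet> i) * (x \<bullet> j) * ((i * j) \<bullet> b))" for x :: 'a
  proof -
    have "x * x = (\<Sum>i\<in>Basis. (x \<bullet> i) *\<^sub>R i) * (\<Sum>j\<in>Basis. (x \<bullet> j) *\<^sub>R j)"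
      by (simp add: euclidean_representation)
    also have "\<dots> = (\<Sum>i\<in>Basis. \<Sum>j\<in>Basis. ((x \<bullet> i) * (x \<bullet> j)) *\<^sub>R (i * j))"
      by (simp add: sum_product mult.commute)
    finally show ?thesis
      by (simp add: inner_sum_left)
  qed
  then show ?thesis
    by (auto intro!: real_polynomial_function_sum real_polynomial_function.intros(4)
        real_polynomial_function.intros(1)[OF bounded_linear_inner_left])
qed

lemma real_algebraic_imaginary_units:
  "real_algebraic_set (imaginary_units :: 'a::{real_algebra_1, euclidean_space} set)"
  unfolding real_algebraic_set_def
proof (intro exI conjI)
  let ?F = "(\<lambda>b x :: 'a. (x * x) \<bullet> b + 1 \<bullet> b) ` Basis"
  show "finite ?F"
    by simp
  show "\<forall>f\<in>?F. real_polynomial_function f"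
    by (auto intro!: real_polynomial_function.intros(3) real_polynomial_function_times
        real_polynomial_function.intros(2))
  have "x * x = - 1 \<longleftrightarrow> (\<forall>b\<in>Basis. (x * x) \<bullet> b + 1 \<bullet> b = 0)" for x :: 'a
    by (simp add: euclidean_eq_iff[of "x * x + 1"] eq_neg_iff_add_eq_0 inner_add_left)
  then show "imaginary_units = {x :: 'a. \<forall>f\<in>?F. f x = 0}"
    by (auto simp: imaginary_units_iff)
qed

text \<open>Differentiating \<gamma> \<gamma> = -1 at 0 gives one inclusion. For the other, the
  inverse Cayley transform carries a straight line in the anticommutant to a curve of imaginary
  units.\<close>

lemma tangent_space_imaginary_units:
  fixes p :: "'a::{real_algebra_1, euclidean_space}"
  assumes p: "p \<in> imaginary_units"
  shows "tangent_space imaginary_units p = anticommutant p"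
proof (intro equalityI subsetI)
  fix v assume "v \<in> tangent_space imaginary_units p"
  then obtain \<gamma> :: "real \<Rightarrow> 'a" and \<epsilon> where \<gamma>: "\<epsilon> > 0" "\<gamma> ` {-\<epsilon><..<\<epsilon>} \<subseteq> imaginary_units"
    "\<gamma> 0 = p" "(\<gamma> has_vector_derivative v) (at 0)"
    unfolding tangent_space_def by blast
  have "((\<lambda>t. \<gamma> t * \<gamma> t) has_vector_derivative (\<gamma> 0 * v + v * \<gamma> 0)) (at 0)"
    using bounded_bilinear.has_vector_derivative[OF bounded_bilinear_times \<gamma>(4) \<gamma>(4)] .
  moreover have "((\<lambda>t. \<gamma> t * \<gamma> t) has_vector_derivative 0) (at 0)"
  proof (rule has_vector_derivative_transform_within_open)
    show "((\<lambda>t. - 1 :: 'a) has_vector_derivative 0) (at 0)"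
      by simp
    show "- 1 = \<gamma> t * \<gamma> t" if "t \<in> {-\<epsilon><..<\<epsilon>}" for t
      using that \<gamma>(2) by (simp add: image_subset_iff imaginary_units_iff)
  qed (use \<gamma> in auto)
  ultimately show "v \<in> anticommutant p"
    using \<gamma>(3) vector_derivative_unique_at unfolding anticommutant_def by blast
next
  fix v assume v: "v \<in> anticommutant p"
  \<comment> \<open>The differential at 0 of the inverse transform based at \<open>p\<close> is k
    |-> - 2 p k, which takes (1/2) p v to v because p p = -1.\<close>
  define k where "k = (1 / 2) *\<^sub>R (p * v)"
  have k: "k \<in> anticommutant p"
    unfolding k_def by (intro subspace_mul subspace_anticommutant times_anticommutant p v)
  define T where "T = {t :: real. 1 + t *\<^sub>R k \<in> invertibles}"
  have cont: "continuous_on UNIV (\<lambda>t :: real. 1 + t *\<^sub>R k)"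
    by (intro continuous_intros)
  have openT: "open T"
    unfolding T_def using open_vimage[OF open_invertibles cont] by (simp add: vimage_def)
  have "1 \<in> (invertibles :: 'a set)"
    by (rule invertiblesI) auto
  then have "0 \<in> T"
    by (simp add: T_def)
  then obtain e where e: "e > 0" "ball 0 e \<subseteq> T"
    using openT openE by blast
  then have sub: "{-e<..<e} \<subseteq> T"
    by (auto simp: subset_iff dist_real_def)
  define \<gamma> where "\<gamma> = (\<lambda>t. cayley_inv p (t *\<^sub>R k))"
  note prod = Ck_on_prod[OF bounded_bilinear_times]
  have "Ck_on n T (\<lambda>t. p * (1 + (- 1) * (t *\<^sub>R k)) * minv (1 + t *\<^sub>R k))" for n
    by (intro prod Ck_on_add Ck_on_minv Ck_on_const Ck_on_bounded_linear[OF bounded_linear_scaleR_left]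
        openT) (auto simp: T_def)
  then have "Ck_on n T \<gamma>" for n
    by (simp add: \<gamma>_def cayley_inv_def)
  then have "smooth_on {-e<..<e} \<gamma>"
    using smooth_onI[OF openT sub] by blast
  moreover have "\<gamma> ` {-e<..<e} \<subseteq> imaginary_units"
    using sub k unfolding \<gamma>_def T_def
    by (auto intro!: cayley_inv_imaginary_unit p subspace_mul[OF subspace_anticommutant]
        simp: cayley_ran_def)
  moreover have minv1: "minv (1 :: 'a) = 1"
    by (rule minv_eqI) auto
  then have "\<gamma> 0 = p"
    by (simp add: \<gamma>_def cayley_inv_def)
  moreover have "(\<gamma> has_vector_derivative v) (at 0)"
  proof -
    have sk: "((\<lambda>t. t *\<^sub>R k) has_derivative (\<lambda>t. t *\<^sub>R k)) (at 0)"
      by (intro bounded_linear_imp_has_derivative bounded_linear_scaleR_left)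
    have a: "((\<lambda>t. 1 + t *\<^sub>R k) has_derivative (\<lambda>t. 0 + t *\<^sub>R k)) (at 0)"
      by (intro has_derivative_add has_derivative_const sk)
    have m: "((\<lambda>t. minv (1 + t *\<^sub>R k)) has_derivative (\<lambda>t. - (t *\<^sub>R k))) (at 0)"
      using has_derivative_compose[OF a, of minv] has_derivative_minv[OF \<open>1 \<in> invertibles\<close>] minv1
      by simp
    have "((\<lambda>t. 1 - t *\<^sub>R k) has_derivative (\<lambda>t. 0 - t *\<^sub>R k)) (at 0)"
      by (intro has_derivative_diff has_derivative_const sk)
    from bounded_linear.has_derivative[OF bounded_bilinear.bounded_linear_right[OF bounded_bilinear_times] this]
    have "((\<lambda>t. p * (1 - t *\<^sub>R k)) has_derivative (\<lambda>t. p * (0 - t *\<^sub>R k))) (at 0)" .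
    from bounded_bilinear.FDERIV[OF bounded_bilinear_times this m]
    have "(\<gamma> has_derivative (\<lambda>t. t *\<^sub>R v)) (at 0)"
      unfolding \<gamma>_def cayley_inv_def
      by (rule has_derivative_eq_rhs)
        (simp add: minv1 k_def imaginary_unit_cancel[OF p] flip: scaleR_add_left)
    then show ?thesis
      by (simp add: has_vector_derivative_def)
  qed
  ultimately show "v \<in> tangent_space imaginary_units p"
    unfolding tangent_space_def using e(1) by blast
qed

lemma almost_complex_structure_imaginary_units:
  "almost_complex_structure (imaginary_units :: 'a::{real_algebra_1, euclidean_space} set) (*)"
  unfolding almost_complex_structure_def
proof
  show "\<forall>p\<in>imaginary_units. complex_structure_on (tangent_space imaginary_units p) ((*) (p :: 'a))"
    using complex_structure_anticommutant tangent_space_imaginary_units by metis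
  \<comment> \<open>Multiplication is smooth on all of \<open>'a \<times> 'a\<close>, which serves
    as the local extension at every point.\<close>
  have "Ck_on k UNIV (\<lambda>x :: 'a \<times> 'a. fst x * snd x)" for k
    by (intro Ck_on_prod[OF bounded_bilinear_times] Ck_on_bounded_linear bounded_linear_fst
        bounded_linear_snd) auto
  then show "smooth_on {(p, v). p \<in> imaginary_units \<and> v \<in> tangent_space imaginary_units p}
      (\<lambda>(p, v :: 'a). p * v)"
    by (intro smooth_onI[of UNIV]) (auto simp: case_prod_unfold)
qed

definition cayley_chart :: "'a::{real_algebra_1, euclidean_space} \<Rightarrow> ('a, 'a) cchart" where
  "cayley_chart s = \<lparr>cdom = cayley_dom s \<inter> imaginary_units, cmap = cayley s,
     cmodel = anticommutant s, cstruct = (*) s\<rparr>"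

text \<open>The differential at \<open>x\<close> is h |-> (1 + t) s h b with b = (1 - s x)^-1. It
  intertwines the structures by two identities: (1 + t) s x = t - 1, which rewrites the definition
  of t, and (1 + t) s = s (1 - t), from anticommutation. Together, (1 + t) s x v = - (1 - t) v = s s
  (1 - t) v = s (1 + t) s v.\<close>

lemma cayley_chart_holomorphic:
  fixes s :: "'a::{real_algebra_1, euclidean_space}"
  assumes s: "s \<in> imaginary_units"
  shows "cayley_chart s \<in> holomorphic_charts imaginary_units (*)"
proof -
  let ?U = "cayley_dom s \<inter> imaginary_units"
  have "inj_on (cayley s) ?U"
    by (rule inj_on_inverseI[of _ "cayley_inv s"]) (auto simp: cayley_inv_cayley[OF s])
  then have "complex_chart (cayley_chart s)"
    using complex_structure_anticommutant[OF s] open_cayley_ran[OF s]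
    by (auto simp: complex_chart_def cayley_chart_def cayley_image_units[OF s] openin_open)
  moreover have "openin (top_of_set imaginary_units) ?U"
    using open_cayley_dom[OF s] by (auto simp: openin_open)
  moreover have "diffeomorphism ?U (cayley s ` ?U) (cayley s) (cayley_inv s)"
    using diffeomorphism_cayley[OF s] unfolding diffeomorphism_def
    by (auto intro: smooth_on_subset cayley_in_ran[OF s] homeomorphism_of_subsets)
  moreover have "\<exists>D. (cayley s has_derivative D) (at x within imaginary_units) \<and>
      (\<forall>v\<in>tangent_space imaginary_units x. D (x * v) = s * D v)" if x: "x \<in> ?U" for x
  proof (intro exI conjI ballI)
    let ?t = "cayley s x" and ?b = "minv (1 - s * x)"
    show "(cayley s has_derivative (\<lambda>h. (1 + ?t) * (s * h) * ?b)) (at x within imaginary_units)"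
      by (rule has_derivative_at_withinI[OF has_derivative_cayley[OF s]]) (use x in blast)
    fix v assume "v \<in> tangent_space imaginary_units x"
    have t: "?t \<in> cayley_ran" "?t \<in> anticommutant s"
      using cayley_image_units[OF s] x by blast+
    have "x * (1 + ?t) = s * (1 - ?t)" "x * (1 + ?t) = (1 + ?t) * s"
      using cayley_inv_intertwines[OF s t] cayley_inv_cayley[OF s] x by simp_all
    then have st: "(1 + ?t) * s = s * (1 - ?t)"
      by simp
    have "?t * (1 - s * x) = 1 + s * x"
      using x by (simp add: cayley_def cayley_dom_def minv_cancel)
    then have "(1 + ?t) * (s * x) = ?t - 1"
      by (simp add: algebra_simps)
    then have "(1 + ?t) * (s * (x * v)) = (?t - 1) * v"
      by (metis mult.assoc)
    also have "\<dots> = s * (s * (1 - ?t) * v)"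
      by (simp add: mult.assoc imaginary_unit_cancel[OF s] left_diff_distrib)
    also have "\<dots> = s * ((1 + ?t) * (s * v))"
      unfolding st[symmetric] by (simp add: mult.assoc)
    finally show "(1 + ?t) * (s * (x * v)) * ?b = s * ((1 + ?t) * (s * v) * ?b)"
      by (simp add: mult.assoc)
  qed
  ultimately show ?thesis
    unfolding holomorphic_charts_def by (auto simp: cayley_chart_def)
qed

lemma integrable_structure_imaginary_units:
  "integrable_structure (imaginary_units :: 'a::{real_algebra_1, euclidean_space} set) (*)"
  unfolding integrable_structure_def
  using cayley_chart_holomorphic cayley_dom_self by (force simp: cayley_chart_def)

section \<open>Changing charts\<close>

text \<open>\<open>N\<close> contains all points of \<open>W\<close> near \<open>z\<close>, so a
  derivative found on a small piece of a chart image is one on the whole of it.\<close>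

lemma at_within_openin:
  assumes "openin (top_of_set E) N" "z \<in> N" "N \<subseteq> W" "W \<subseteq> E"
  shows "at z within N = at z within W"
proof -
  obtain O' where "open O'" "N = E \<inter> O'"
    using assms(1) by (auto simp: openin_open)
  then show ?thesis
    using assms by (intro at_within_nhd[of z O']) auto
qed

text \<open>Derivatives within \<open>W\<close> are determined only along \<open>E\<close>.
  Restriction to a line in such a direction turns them into ordinary derivatives of curves at
  0.\<close>

lemma has_derivative_along_line:
  assumes f: "(f has_derivative D) (at x within W)"
    and W: "openin (top_of_set E) W" "x \<in> W" and E: "subspace E" "v \<in> E"
  shows "\<forall>\<^sub>F t in at 0. x + t *\<^sub>R v \<in> W" (is ?ev)
    and "((\<lambda>t. f (x + t *\<^sub>R v)) has_vector_derivative D v) (at 0)" (is ?deriv)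
proof -
  obtain O' where O': "open O'" "W = E \<inter> O'"
    using W(1) by (auto simp: openin_open)
  define T where "T = (\<lambda>t :: real. x + t *\<^sub>R v) -` O'"
  have "continuous_on UNIV (\<lambda>t :: real. x + t *\<^sub>R v)"
    by (intro continuous_intros)
  then have T: "open T"
    unfolding T_def by (rule open_vimage[OF O'(1)])
  have "0 \<in> T"
    using W(2) O' by (simp add: T_def)
  have sub: "x + t *\<^sub>R v \<in> W" if "t \<in> T" for t
    using that W(2) E O' by (auto simp: T_def intro: subspace_add subspace_scale)
  show ?ev
    using T \<open>0 \<in> T\<close> sub by (metis (mono_tags, lifting) eventually_at_topological)
  have "((\<lambda>t. x + t *\<^sub>R v) has_derivative (\<lambda>t. 0 + t *\<^sub>R v)) (at 0 within T)"
    by (intro has_derivative_add has_derivative_const bounded_linear_imp_has_derivative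
        bounded_linear_scaleR_left)
  then have line: "((\<lambda>t. x + t *\<^sub>R v) has_derivative (\<lambda>t. t *\<^sub>R v)) (at 0 within T)"
    by simp
  have "(f has_derivative D) (at (x + 0 *\<^sub>R v) within (\<lambda>t. x + t *\<^sub>R v) ` T)"
    using has_derivative_subset[OF f] sub by (simp add: image_subset_iff)
  from diff_chain_within[OF line this]
  have "((\<lambda>t. f (x + t *\<^sub>R v)) has_derivative (\<lambda>t. D (t *\<^sub>R v))) (at 0 within T)"
    by (simp add: o_def)
  moreover have "D (t *\<^sub>R v) = t *\<^sub>R D v" for t
    using has_derivative_bounded_linear[OF f] by (simp add: bounded_linear.linear linear_cmul)
  ultimately show ?deriv
    using at_within_open[OF \<open>0 \<in> T\<close> T] by (simp add: has_vector_derivative_def)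
qed

text \<open>The value D v is a limit of difference quotients, which lie in \<open>E'\<close>;
  closedness keeps the limit there. With {0} as \<open>E'\<close> this also shows that a vanishing
  function has derivative zero along \<open>E\<close>.\<close>

lemma has_derivative_in_closed_subspace:
  assumes f: "(f has_derivative D) (at x within W)"
    and W: "openin (top_of_set E) W" "x \<in> W" and E: "subspace E" "v \<in> E"
    and E': "subspace E'" "closed E'" "f ` W \<subseteq> E'"
  shows "D v \<in> E'"
proof -
  let ?q = "\<lambda>t. (f (x + t *\<^sub>R v) - f x) /\<^sub>R t"
  have "((\<lambda>h. norm (f (x + (0 + h) *\<^sub>R v) - f (x + 0 *\<^sub>R v) - h *\<^sub>R D v) / norm h) \<longlongrightarrow> 0) (at 0)"
    using has_derivative_along_line(2)[OF f W E]
    unfolding has_vector_derivative_def has_derivative_at by blast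
  then have "((\<lambda>t. norm (?q t - D v)) \<longlongrightarrow> 0) (at 0)"
  proof (rule Lim_transform_eventually)
    have "norm (f (x + (0 + t) *\<^sub>R v) - f (x + 0 *\<^sub>R v) - t *\<^sub>R D v) / norm t = norm (?q t - D v)"
      if "t \<noteq> 0" for t
    proof -
      have "?q t - D v = (f (x + t *\<^sub>R v) - f x - t *\<^sub>R D v) /\<^sub>R t"
        using that by (simp add: algebra_simps)
      then show ?thesis
        by (simp add: divide_inverse mult.commute)
    qed
    then show "\<forall>\<^sub>F t in at 0. norm (f (x + (0 + t) *\<^sub>R v) - f (x + 0 *\<^sub>R v) - t *\<^sub>R D v) / norm t =
        norm (?q t - D v)"
      by (auto simp: eventually_at_filter)
  qed
  from LIM_zero_cancel[OF tendsto_norm_zero_cancel[OF this]]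
  have "(?q \<longlongrightarrow> D v) (at 0)" .
  moreover have "\<forall>\<^sub>F t in at 0. ?q t \<in> E'"
    using has_derivative_along_line(1)[OF f W E]
  proof (rule eventually_mono)
    show "?q t \<in> E'" if "x + t *\<^sub>R v \<in> W" for t
      using that W(2) E'(3) by (intro subspace_scale subspace_diff E'(1)) blast+
  qed
  ultimately show ?thesis
    by (intro Lim_in_closed_set[OF E'(2) _ trivial_limit_at, of ?q]) auto
qed

section \<open>Holomorphic maps in charts, maximal atlases and submanifold atlases\<close>

lemma complex_chart_simps:
  assumes "complex_chart c"
  shows "subspace (cmodel c)" "inj_on (cmap c) (cdom c)"
    "openin (top_of_set (cmodel c)) (cmap c ` cdom c)" "cmap c ` cdom c \<subseteq> cmodel c"
    "\<And>v. v \<in> cmodel c \<Longrightarrow> cstruct c v \<in> cmodel c"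
  using assms openin_imp_subset[of _ "cmodel c" "cmap c ` cdom c"]
  by (auto simp: complex_chart_def complex_structure_on_def)

lemma holo_in_chartsD:
  assumes "holo_in_charts c d f" "complex_chart c" "x \<in> cdom c" "f x \<in> cdom d"
  obtains D where
    "((\<lambda>z. cmap d (f (inv_into (cdom c) (cmap c) z))) has_derivative D)
       (at (cmap c x) within cmap c ` {x \<in> cdom c. f x \<in> cdom d})"
    "\<And>v. v \<in> cmodel c \<Longrightarrow> D (cstruct c v) = cstruct d (D v)"
  using assms unfolding holo_in_charts_def holo_on_def Let_def by blast

text \<open>Holomorphy entails continuity of the coordinate expression, so preimages of sets open in
  the target chart are open in the source chart.\<close>

lemma holo_in_charts_openin:
  assumes "holo_in_charts c d f" "complex_chart c" "complex_chart d"
    and "D \<subseteq> cdom d" "openin (top_of_set (cmodel d)) (cmap d ` D)"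
  shows "openin (top_of_set (cmodel c)) (cmap c ` {x \<in> cdom c. f x \<in> D})"
proof -
  define W where "W = cmap c ` {x \<in> cdom c. f x \<in> cdom d}"
  define F where "F = (\<lambda>z. cmap d (f (inv_into (cdom c) (cmap c) z)))"
  have F: "F (cmap c x) = cmap d (f x)" if "x \<in> cdom c" for x
    using that complex_chart_simps(2)[OF assms(2)] by (simp add: F_def)
  have W: "openin (top_of_set (cmodel c)) W"
    using assms(1) by (simp add: holo_in_charts_def W_def Let_def)
  have "continuous_on W F"
    using assms(1) has_derivative_continuous
    unfolding continuous_on_eq_continuous_within holo_in_charts_def holo_on_def Let_def F_def W_def
    by blast
  moreover have "F \<in> W \<rightarrow> cmodel d"
    using complex_chart_simps(4)[OF assms(3)] F by (auto simp: W_def)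
  ultimately have "openin (top_of_set W) (W \<inter> F -` (cmap d ` D))"
    using assms(5) by (rule continuous_openin_preimage)
  moreover have "W \<inter> F -` (cmap d ` D) = cmap c ` {x \<in> cdom c. f x \<in> D}"
    using assms(4) F inj_onD[OF complex_chart_simps(2)[OF assms(3)]]
    by (auto simp: W_def image_iff subset_iff) metis+
  ultimately show ?thesis
    using W openin_trans by metis
qed

text \<open>The intermediate chart may depend on the point, and its model has to be closed for the
  derivative of the first map to take values in it.\<close>

lemma holo_in_charts_compose:
  fixes c :: "('x, 'e::real_normed_vector) cchart" and e :: "('z, 'g::real_normed_vector) cchart"
    and f :: "'x \<Rightarrow> 'y"
  assumes c: "complex_chart c"
    and mid: "\<And>x. x \<in> cdom c \<Longrightarrow> h x \<in> cdom e \<Longrightarrow>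
      \<exists>d :: ('y, 'f::real_normed_vector) cchart. complex_chart d \<and> closed (cmodel d) \<and> f x \<in> cdom d \<and>
        holo_in_charts c d f \<and> holo_in_charts d e g"
    and h: "\<And>x. x \<in> cdom c \<Longrightarrow> h x = g (f x)"
  shows "holo_in_charts c e h"
proof -
  define W where "W = cmap c ` {x \<in> cdom c. h x \<in> cdom e}"
  define k where "k = (\<lambda>z. cmap e (h (inv_into (cdom c) (cmap c) z)))"
  note inj_c = complex_chart_simps(2)[OF c]
  have WE: "W \<subseteq> cmodel c"
    using complex_chart_simps(4)[OF c] by (auto simp: W_def)
  \<comment> \<open>Near \<open>z\<close> a single intermediate chart is used; \<open>N\<close> is
    the relatively open set where both coordinate expressions are defined, and a derivative there is
    one within \<open>W\<close>. The sets \<open>N\<close> also exhaust \<open>W\<close>, which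
    proves \<open>W\<close> open.\<close>
  have main: "\<exists>N D. openin (top_of_set (cmodel c)) N \<and> z \<in> N \<and> N \<subseteq> W \<and>
      (k has_derivative D) (at z within W) \<and>
      (\<forall>v\<in>cmodel c. D (cstruct c v) = cstruct e (D v))" if "z \<in> W" for z
  proof -
    obtain x where x: "x \<in> cdom c" "h x \<in> cdom e" "z = cmap c x"
      using \<open>z \<in> W\<close> by (auto simp: W_def)
    obtain d :: "('y, 'f) cchart" where d: "complex_chart d" "closed (cmodel d)" "f x \<in> cdom d"
      "holo_in_charts c d f" "holo_in_charts d e g"
      using mid[OF x(1,2)] by blast
    define W1 where "W1 = cmap c ` {x \<in> cdom c. f x \<in> cdom d}"
    define F where "F = (\<lambda>z. cmap d (f (inv_into (cdom c) (cmap c) z)))"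
    define W2 where "W2 = cmap d ` {y \<in> cdom d. g y \<in> cdom e}"
    define G where "G = (\<lambda>z. cmap e (g (inv_into (cdom d) (cmap d) z)))"
    define N where "N = cmap c ` {x \<in> cdom c. f x \<in> {y \<in> cdom d. g y \<in> cdom e}}"
    obtain D1 where D1: "(F has_derivative D1) (at z within W1)"
      "\<And>v. v \<in> cmodel c \<Longrightarrow> D1 (cstruct c v) = cstruct d (D1 v)"
      using holo_in_chartsD[OF d(4) c x(1) d(3)] unfolding F_def W1_def x(3) by blast
    have gfx: "g (f x) \<in> cdom e"
      using x h by simp
    obtain D2 where D2: "(G has_derivative D2) (at (cmap d (f x)) within W2)"
      "\<And>v. v \<in> cmodel d \<Longrightarrow> D2 (cstruct d v) = cstruct e (D2 v)"
      using holo_in_chartsD[OF d(5,1,3) gfx] unfolding G_def W2_def by blast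
    have F: "F (cmap c y) = cmap d (f y)" if "y \<in> cdom c" for y
      using that inj_c by (simp add: F_def)
    have W1: "openin (top_of_set (cmodel c)) W1"
      using d(4) by (simp add: holo_in_charts_def W1_def Let_def)
    have W2: "openin (top_of_set (cmodel d)) W2"
      using d(5) by (simp add: holo_in_charts_def W2_def Let_def)
    have N: "openin (top_of_set (cmodel c)) N"
      unfolding N_def by (rule holo_in_charts_openin[OF d(4) c d(1)]) (use W2 W2_def in auto)
    have zN: "z \<in> N" and NW: "N \<subseteq> W" and NW1: "N \<subseteq> W1"
      using x h d(3) by (auto simp: N_def W_def W1_def)
    have "(F has_derivative D1) (at z within N)"
      using has_derivative_subset[OF D1(1) NW1] .
    moreover have "(G has_derivative D2) (at (F z) within F ` N)"
      using has_derivative_subset[OF D2(1), of "F ` N"] F x by (auto simp: N_def W2_def)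
    ultimately have "(G \<circ> F has_derivative D2 \<circ> D1) (at z within N)"
      by (rule diff_chain_within)
    then have "(k has_derivative D2 \<circ> D1) (at z within N)"
      using zN
    proof (rule has_derivative_transform[rotated 2])
      show "k y = (G \<circ> F) y" if "y \<in> N" for y
        using that inj_c complex_chart_simps(2)[OF d(1)] h by (auto simp: N_def k_def G_def F_def)
    qed
    then have "(k has_derivative D2 \<circ> D1) (at z within W)"
      using at_within_openin[OF N zN NW WE] by simp
    \<comment> \<open>Complex linearity of \<open>D2\<close> is known on \<open>cmodel d\<close>
      only, so \<open>D1\<close> has to map into that subspace.\<close>
    moreover have "D1 v \<in> cmodel d" if "v \<in> cmodel c" for v
      using D1(1) W1 _ complex_chart_simps(1)[OF c] that complex_chart_simps(1)[OF d(1)] d(2)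
      by (rule has_derivative_in_closed_subspace)
        (use zN NW1 F complex_chart_simps(4)[OF d(1)] in \<open>auto simp: W1_def\<close>)
    ultimately show ?thesis
      using N zN NW D1(2) D2(2) by (intro exI[of _ N] exI[of _ "D2 \<circ> D1"]) auto
  qed
  have "openin (top_of_set (cmodel c)) W"
    using main by (subst openin_subopen) blast
  then show ?thesis
    using main unfolding holo_in_charts_def holo_on_def Let_def W_def[symmetric] k_def[symmetric]
    by blast
qed

text \<open>Shrinking the domain changes \<open>inv_into\<close>, but on the smaller image both
  inverses return the same point. Derivatives restrict, while openness of the new coordinate domain
  has to be supplied.\<close>

lemma holo_in_charts_restrict:
  assumes "holo_in_charts c d f" "complex_chart c"
    and D: "D \<subseteq> cdom c" "D' \<subseteq> cdom d" "F \<subseteq> cmodel c"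
    and "openin (top_of_set F) (cmap c ` {x \<in> D. f x \<in> D'})"
  shows "holo_in_charts (c\<lparr>cdom := D, cmodel := F\<rparr>) (d\<lparr>cdom := D', cmodel := F'\<rparr>) f"
proof -
  have "\<exists>\<Delta>. ((\<lambda>z. cmap d (f (inv_into D (cmap c) z))) has_derivative \<Delta>)
        (at (cmap c x) within cmap c ` {x \<in> D. f x \<in> D'}) \<and>
      (\<forall>v\<in>F. \<Delta> (cstruct c v) = cstruct d (\<Delta> v))" if x: "x \<in> D" "f x \<in> D'" for x
  proof -
    obtain \<Delta> where \<Delta>: "((\<lambda>z. cmap d (f (inv_into (cdom c) (cmap c) z))) has_derivative \<Delta>)
       (at (cmap c x) within cmap c ` {x \<in> cdom c. f x \<in> cdom d})"
      "\<And>v. v \<in> cmodel c \<Longrightarrow> \<Delta> (cstruct c v) = cstruct d (\<Delta> v)"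
      using holo_in_chartsD[OF assms(1,2)] x D by blast
    have "((\<lambda>z. cmap d (f (inv_into (cdom c) (cmap c) z))) has_derivative \<Delta>)
       (at (cmap c x) within cmap c ` {x \<in> D. f x \<in> D'})"
      using \<Delta>(1) by (rule has_derivative_subset) (use D in auto)
    then have "((\<lambda>z. cmap d (f (inv_into D (cmap c) z))) has_derivative \<Delta>)
       (at (cmap c x) within cmap c ` {x \<in> D. f x \<in> D'})"
    proof (rule has_derivative_transform[rotated 2])
      fix z assume "z \<in> cmap c ` {x \<in> D. f x \<in> D'}"
      then obtain y where "y \<in> D" "z = cmap c y"
        by auto
      moreover have "inj_on (cmap c) (cdom c)" "inj_on (cmap c) D"
        using complex_chart_simps(2)[OF assms(2)] D(1) by (auto intro: inj_on_subset)
      ultimately show "cmap d (f (inv_into D (cmap c) z)) = cmap d (f (inv_into (cdom c) (cmap c) z))"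
        using D(1) by (metis inv_into_f_f subsetD)
    qed (use x in auto)
    then show ?thesis
      using \<Delta>(2) D(3) by blast
  qed
  then show ?thesis
    using assms(6) by (auto simp: holo_in_charts_def holo_on_def Let_def)
qed

text \<open>Each point of \<open>c\<close> lies in a chart of the atlas itself, which is compatible
  with both given charts; the coordinate change is composed through it.\<close>

lemma maximal_atlas_compatible:
  assumes "complex_atlas \<A>" "\<And>d. d \<in> \<A> \<Longrightarrow> closed (cmodel d)"
    and "c \<in> maximal_atlas \<A>" "c' \<in> maximal_atlas \<A>"
  shows "holo_in_charts c c' (\<lambda>x. x)"
proof -
  have "\<exists>d\<in>\<A>. complex_chart d \<and> closed (cmodel d) \<and> x \<in> cdom d \<and>
      holo_in_charts c d (\<lambda>x. x) \<and> holo_in_charts d c' (\<lambda>x. x)" if x: "x \<in> cdom c" for x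
  proof -
    obtain d where "d \<in> \<A>" "x \<in> cdom d"
      using assms(3) x by (auto simp: maximal_atlas_def atlas_carrier_def)
    moreover from this have "complex_chart d" "closed (cmodel d)" "holo_in_charts c d (\<lambda>x. x)"
      "holo_in_charts d c' (\<lambda>x. x)"
      using assms by (auto simp: maximal_atlas_def complex_atlas_def compatible_charts_def)
    ultimately show ?thesis
      by blast
  qed
  moreover have "complex_chart c"
    using assms(3) by (simp add: maximal_atlas_def)
  ultimately show ?thesis
    using holo_in_charts_compose[of c "\<lambda>x. x" c' "\<lambda>x. x" "\<lambda>x. x"] by blast
qed

lemma maximal_atlas_restrict:
  assumes "complex_atlas \<A>" "c \<in> \<A>" "D \<subseteq> cdom c" "openin (top_of_set (cmodel c)) (cmap c ` D)"
  shows "c\<lparr>cdom := D\<rparr> \<in> maximal_atlas \<A>"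
proof -
  have c: "complex_chart c"
    using assms by (simp add: complex_atlas_def)
  have "complex_chart (c\<lparr>cdom := D\<rparr>)"
    using c assms(3,4) by (auto simp: complex_chart_def intro: inj_on_subset)
  moreover have "compatible_charts (c\<lparr>cdom := D\<rparr>) d" if "d \<in> \<A>" for d
  proof -
    have d: "complex_chart d" "holo_in_charts c d (\<lambda>x. x)" "holo_in_charts d c (\<lambda>x. x)"
      using assms that by (auto simp: complex_atlas_def compatible_charts_def)
    have "openin (top_of_set (cmodel d)) (cmap d ` {x \<in> cdom d. x \<in> D})"
      by (rule holo_in_charts_openin[OF d(3,1) c assms(3,4)])
    from holo_in_charts_restrict[OF d(3,1) subset_refl assms(3) subset_refl this, where F' = "cmodel c"]
    have dc: "holo_in_charts d (c\<lparr>cdom := D\<rparr>) (\<lambda>x. x)"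
      by simp
    have "openin (top_of_set (cmodel c)) (cmap c ` {x \<in> cdom c. x \<in> cdom d})"
      using d(2) by (simp add: holo_in_charts_def Let_def)
    then have "openin (top_of_set (cmodel c)) (cmap c ` {x \<in> cdom c. x \<in> cdom d} \<inter> cmap c ` D)"
      using assms(4) by (rule openin_Int)
    moreover have "cmap c ` {x \<in> cdom c. x \<in> cdom d} \<inter> cmap c ` D = cmap c ` {x \<in> D. x \<in> cdom d}"
      using complex_chart_simps(2)[OF c] assms(3) by (auto dest: inj_onD)
    ultimately have "openin (top_of_set (cmodel c)) (cmap c ` {x \<in> D. x \<in> cdom d})"
      by simp
    from holo_in_charts_restrict[OF d(2) c assms(3) subset_refl subset_refl this, where F' = "cmodel d"]
    have "holo_in_charts (c\<lparr>cdom := D\<rparr>) d (\<lambda>x. x)"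
      by simp
    with dc show ?thesis
      by (simp add: compatible_charts_def)
  qed
  ultimately show ?thesis
    using assms(2,3) by (auto simp: maximal_atlas_def atlas_carrier_def)
qed

lemma submanifold_atlas_chart:
  assumes "c \<in> submanifold_atlas \<A> M"
  shows "complex_chart c"
proof -
  obtain b F where c: "c = b\<lparr>cdom := cdom b \<inter> M, cmodel := F\<rparr>" and b: "complex_chart b"
    and F: "subspace F" "F \<subseteq> cmodel b" "cstruct b ` F \<subseteq> F"
    "cmap b ` (cdom b \<inter> M) = cmap b ` cdom b \<inter> F"
    using assms by (auto simp: submanifold_atlas_def maximal_atlas_def)
  have "complex_structure_on F (cstruct b)"
    using b F(1-3) unfolding complex_chart_def complex_structure_on_def by (simp add: subset_iff image_subset_iff)
  moreover have "openin (top_of_set F) (cmap b ` cdom b \<inter> F)"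
    using complex_chart_simps(3)[OF b] F(2) by (auto simp: openin_open)
  ultimately show ?thesis
    using b F(4) by (auto simp: c complex_chart_def intro: inj_on_subset)
qed

lemma submanifold_atlas_compatible:
  assumes "complex_atlas \<A>" "\<And>d. d \<in> \<A> \<Longrightarrow> closed (cmodel d)"
    and "c \<in> submanifold_atlas \<A> M" "c' \<in> submanifold_atlas \<A> M"
  shows "holo_in_charts c c' (\<lambda>x. x)"
proof -
  obtain b F where c: "c = b\<lparr>cdom := cdom b \<inter> M, cmodel := F\<rparr>" and b: "b \<in> maximal_atlas \<A>"
    and F: "F \<subseteq> cmodel b" "cmap b ` (cdom b \<inter> M) = cmap b ` cdom b \<inter> F"
    using assms(3) by (auto simp: submanifold_atlas_def)
  obtain b' F' where c': "c' = b'\<lparr>cdom := cdom b' \<inter> M, cmodel := F'\<rparr>" and b': "b' \<in> maximal_atlas \<A>"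
    using assms(4) by (auto simp: submanifold_atlas_def)
  have bb': "holo_in_charts b b' (\<lambda>x. x)"
    using maximal_atlas_compatible[OF assms(1,2)] b b' by blast
  have chart: "complex_chart b"
    using b by (simp add: maximal_atlas_def)
  have "openin (top_of_set (cmodel b)) (cmap b ` {x \<in> cdom b. x \<in> cdom b'})"
    using bb' by (simp add: holo_in_charts_def Let_def)
  then have "openin (top_of_set F) (cmap b ` {x \<in> cdom b. x \<in> cdom b'} \<inter> F)"
    using F(1) by (auto simp: openin_open)
  moreover have "cmap b ` {x \<in> cdom b. x \<in> cdom b'} \<inter> F = cmap b ` {x \<in> cdom b \<inter> M. x \<in> cdom b' \<inter> M}"
  proof -
    \<comment> \<open>Flatness puts \<open>cmap b x\<close> in the image of
      \<open>cdom b \<inter> M\<close>, and injectivity of the chart identifies the preimage as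
      \<open>x\<close>.\<close>
    have "x \<in> M" if "x \<in> cdom b" "cmap b x \<in> F" for x
    proof -
      have "cmap b x \<in> cmap b ` (cdom b \<inter> M)"
        using that F(2) by blast
      then show ?thesis
        using that inj_onD[OF complex_chart_simps(2)[OF chart]] by blast
    qed
    then show ?thesis
      using F(2) by auto
  qed
  ultimately show ?thesis
    unfolding c c' by (intro holo_in_charts_restrict[OF bb' chart] F(1)) auto
qed

section \<open>Complementary subspaces and projections\<close>

definition proj :: "'v::real_vector set \<Rightarrow> 'v set \<Rightarrow> 'v \<Rightarrow> 'v" where
  "proj P Q x = (THE p. p \<in> P \<and> x - p \<in> Q)"

lemma complementary_unique:
  assumes "subspace P" "subspace Q" "complementary P Q" "p \<in> P" "x - p \<in> Q" "p' \<in> P" "x - p' \<in> Q"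
  shows "p = p'"
proof -
  have "p - p' \<in> P"
    using assms by (simp add: subspace_diff)
  moreover have "(x - p') - (x - p) \<in> Q"
    using assms subspace_diff by blast
  then have "p - p' \<in> Q"
    by simp
  ultimately show ?thesis
    using assms(3) unfolding complementary_def by (metis IntI eq_iff_diff_eq_0 singletonD)
qed

context
  fixes P Q :: "'v::real_vector set"
  assumes PQ: "subspace P" "subspace Q" "complementary P Q"
begin

lemma proj_eqI: "p \<in> P \<Longrightarrow> x - p \<in> Q \<Longrightarrow> proj P Q x = p"
  unfolding proj_def using complementary_unique[OF PQ] by (intro the_equality) auto

lemma proj_in: "proj P Q x \<in> P" and diff_proj_in: "x - proj P Q x \<in> Q"
proof -
  obtain p q where "p \<in> P" "q \<in> Q" "x = p + q"
    using PQ(3) unfolding complementary_def by blast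
  then show "proj P Q x \<in> P" "x - proj P Q x \<in> Q"
    using proj_eqI[of p x] by auto
qed

lemma proj_left: "x \<in> P \<Longrightarrow> proj P Q x = x"
  using PQ by (intro proj_eqI) (auto simp: subspace_0)

lemma proj_right: "x \<in> Q \<Longrightarrow> proj P Q x = 0"
  using PQ by (intro proj_eqI) (auto simp: subspace_0)

lemma linear_proj: "linear (proj P Q)"
proof (rule linearI)
  show "proj P Q (x + y) = proj P Q x + proj P Q y" for x y
  proof (rule proj_eqI)
    have "(x - proj P Q x) + (y - proj P Q y) \<in> Q"
      by (intro subspace_add PQ diff_proj_in)
    then show "x + y - (proj P Q x + proj P Q y) \<in> Q"
      by (simp add: algebra_simps)
  qed (intro subspace_add PQ proj_in)
  show "proj P Q (r *\<^sub>R x) = r *\<^sub>R proj P Q x" for r x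
  proof (rule proj_eqI)
    have "r *\<^sub>R (x - proj P Q x) \<in> Q"
      by (intro subspace_scale PQ diff_proj_in)
    then show "r *\<^sub>R x - r *\<^sub>R proj P Q x \<in> Q"
      by (simp add: scaleR_right_diff_distrib)
  qed (intro subspace_scale PQ proj_in)
qed

end

definition bproj :: "'v::euclidean_space set \<Rightarrow> 'v set \<Rightarrow> 'v \<Rightarrow>\<^sub>L 'v" where
  "bproj P Q = Blinfun (proj P Q)"

lemma bproj_apply:
  assumes "subspace P" "subspace Q" "complementary P Q"
  shows "blinfun_apply (bproj P Q) = proj P Q"
  unfolding bproj_def using linear_proj[OF assms]
  by (simp add: bounded_linear_Blinfun_apply linear_conv_bounded_linear)

text \<open>The graph of \<open>T\<close> over \<open>P\<close> when \<open>T\<close> has values in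
  a complement of \<open>P\<close>. Keeping the base as an argument lets one pass from
  \<open>P\<close> to a nearby subspace.\<close>

definition shear :: "('v::real_normed_vector \<Rightarrow>\<^sub>L 'v) \<Rightarrow> 'v set \<Rightarrow> 'v set" where
  "shear T P = (\<lambda>p. p + blinfun_apply T p) ` P"

text \<open>With \<pi> the projection onto \<open>W\<close> along \<open>R\<close>, the map B = 1 +
  H \<pi> is invertible because norm (H \<pi>) < 1. It sends w in \<open>W\<close> to w + H w and
  fixes \<open>R\<close> pointwise, so it carries the given splitting to the one by the shear and
  \<open>R\<close>.\<close>

lemma complementary_shear:
  fixes W R :: "'v::euclidean_space set"
  assumes WR: "subspace W" "subspace R" "complementary W R" and H: "norm (H o\<^sub>L bproj W R) < 1"
  shows "complementary (shear H W) R"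
proof -
  let ?\<pi> = "proj W R"
  define B where "B = (\<lambda>x. x + blinfun_apply H (?\<pi> x))"
  note lin = linear_proj[OF WR]
  have "linear B"
    unfolding B_def
    by (rule linearI) (simp_all add: linear_add[OF lin] linear_scale[OF lin] blinfun.add_right
        blinfun.scaleR_right scaleR_add_right)
  have B0: "x = 0" if "B x = 0" for x
  proof (rule contraction_zero[OF H])
    have "x = - blinfun_apply (H o\<^sub>L bproj W R) x"
      using that by (simp add: B_def bproj_apply[OF WR] eq_neg_iff_add_eq_0)
    then show "norm x \<le> norm (H o\<^sub>L bproj W R) * norm x"
      by (metis norm_blinfun norm_minus_cancel)
  qed
  then have "surj B"
    using linear_injective_0[OF \<open>linear B\<close>] linear_inj_imp_surj[OF \<open>linear B\<close>] by blast
  have "\<exists>p\<in>shear H W. \<exists>q\<in>R. v = p + q" for v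
  proof -
    obtain x where "v = B x"
      using \<open>surj B\<close> by (metis surjD)
    then have "v = (?\<pi> x + blinfun_apply H (?\<pi> x)) + (x - ?\<pi> x)"
      by (simp add: B_def)
    then show ?thesis
      using proj_in[OF WR] diff_proj_in[OF WR] unfolding shear_def by blast
  qed
  moreover have "w + blinfun_apply H w = 0" if w: "w \<in> W" "w + blinfun_apply H w \<in> R" for w
  proof -
    \<comment> \<open>The vector - H w has \<open>W\<close>-component \<open>w\<close>, hence is
      annihilated by \<open>B\<close>; so H w = 0 and \<open>w\<close> itself lies in
      \<open>R\<close>.\<close>
    have "- blinfun_apply H w - w \<in> R"
      using subspace_neg[OF WR(2) w(2)] by (simp only: minus_add add_uminus_conv_diff)
    then have "?\<pi> (- blinfun_apply H w) = w"
      using w(1) by (intro proj_eqI[OF WR])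
    then have "B (- blinfun_apply H w) = 0"
      by (simp add: B_def)
    then have Hw: "blinfun_apply H w = 0"
      using B0 neg_equal_0_iff_equal by blast
    then have "w \<in> W \<inter> R"
      using w by simp
    then have "w = 0"
      using WR(3) unfolding complementary_def by blast
    then show ?thesis
      using Hw by simp
  qed
  moreover have "0 \<in> shear H W" "0 \<in> R"
    using subspace_0[OF WR(1)] subspace_0[OF WR(2)] by (force simp: shear_def)+
  ultimately show ?thesis
    unfolding complementary_def by (auto simp: shear_def)
qed

section \<open>Complex subspaces of the complexification\<close>

lemma scaleC_i: "scaleC \<i> x = (- snd x, fst x)"
  by (simp add: scaleC_def)

lemma scaleC_eq: "scaleC c x = Re c *\<^sub>R x + Im c *\<^sub>R scaleC \<i> x"
  by (simp add: scaleC_def prod_eq_iff)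

text \<open>The scalar \<open>c\<close> acts as Re c + Im c \<i>. Splittings can thus be treated by
  real linear algebra, with invariance under \<i> as a side condition.\<close>

lemma complex_subspace_iff:
  "module.subspace scaleC W \<longleftrightarrow> subspace W \<and> (\<forall>x\<in>W. scaleC \<i> x \<in> W)"
  for W :: "'a::real_vector complexification set"
proof -
  interpret V: vector_space "scaleC :: complex \<Rightarrow> 'a \<times> 'a \<Rightarrow> 'a \<times> 'a"
    by (rule vector_space_scaleC)
  have real: "scaleC (complex_of_real r) x = r *\<^sub>R x" for r and x :: "'a \<times> 'a"
    by (simp add: scaleC_def prod_eq_iff)
  show ?thesis
  proof
    assume W: "V.subspace W"
    then show "subspace W \<and> (\<forall>x\<in>W. scaleC \<i> x \<in> W)"
      using V.subspace_scale[OF W] V.subspace_0[OF W] V.subspace_add[OF W]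
      by (auto intro!: subspaceI simp flip: real)
  next
    assume W: "subspace W \<and> (\<forall>x\<in>W. scaleC \<i> x \<in> W)"
    show "V.subspace W"
    proof (rule V.subspaceI)
      show "scaleC c x \<in> W" if "x \<in> W" for c x
        using W that by (subst scaleC_eq) (auto intro!: subspace_add subspace_scale)
    qed (use W in \<open>auto simp: subspace_0 subspace_add\<close>)
  qed
qed

lemma linear_scaleC: "linear (scaleC c :: 'a::real_vector complexification \<Rightarrow> _)"
  by (rule linearI) (auto simp: scaleC_def algebra_simps)

text \<open>Multiplication by \<i> preserves both summands, hence takes the decomposition of
  \<open>x\<close> to that of its multiple; decompositions are unique.\<close>

lemma proj_scaleC:
  fixes P :: "'a::real_vector complexification set"
  assumes "module.subspace scaleC P" "module.subspace scaleC Q" "complementary P Q"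
  shows "proj P Q (scaleC \<i> x) = scaleC \<i> (proj P Q x)"
proof -
  have PQ: "subspace P" "subspace Q" "complementary P Q"
    and i: "\<And>x. x \<in> P \<Longrightarrow> scaleC \<i> x \<in> P" "\<And>x. x \<in> Q \<Longrightarrow> scaleC \<i> x \<in> Q"
    using assms unfolding complex_subspace_iff by blast+
  show ?thesis
  proof (rule proj_eqI[OF PQ])
    show "scaleC \<i> (proj P Q x) \<in> P"
      by (intro i proj_in PQ)
    have "scaleC \<i> (x - proj P Q x) \<in> Q"
      by (intro i diff_proj_in PQ)
    then show "scaleC \<i> x - scaleC \<i> (proj P Q x) \<in> Q"
      by (simp add: linear_diff[OF linear_scaleC])
  qed
qed

lemma complex_dim_image:
  fixes f :: "'a::real_vector complexification \<Rightarrow> 'a complexification"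
  assumes f: "linear f" "\<And>x. f (scaleC \<i> x) = scaleC \<i> (f x)" "inj f"
    and W: "module.subspace scaleC W"
  shows "vector_space.dim scaleC (f ` W) = vector_space.dim scaleC W"
proof -
  interpret V: vector_space "scaleC :: complex \<Rightarrow> 'a \<times> 'a \<Rightarrow> 'a \<times> 'a"
    by (rule vector_space_scaleC)
  interpret VV: vector_space_pair "scaleC :: complex \<Rightarrow> 'a \<times> 'a \<Rightarrow> 'a \<times> 'a" "scaleC :: complex \<Rightarrow> 'a \<times> 'a \<Rightarrow> 'a \<times> 'a" ..
  have lin: "Vector_Spaces.linear scaleC scaleC f"
  proof (unfold_locales)
    show "f (scaleC c x) = scaleC c (f x)" for c x
      by (simp only: scaleC_eq[of c] linear_add[OF f(1)] linear_scale[OF f(1)] f(2))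
  qed (rule linear_add[OF f(1)])
  obtain B where B: "B \<subseteq> W" "V.independent B" "W \<subseteq> V.span B" "card B = V.dim W"
    using V.basis_exists by blast
  then have WB: "W = V.span B"
    using W V.span_minimal by blast
  have "V.independent (f ` B)"
    using VV.linear_independent_injective_image[OF lin B(2)] inj_on_subset[OF f(3)] by blast
  moreover have "V.span (f ` B) = V.span (f ` W)"
    using VV.linear_span_image[OF lin] WB V.span_span by metis
  ultimately have "V.dim (f ` W) = card (f ` B)"
    by (metis V.dim_eq_card)
  also have "\<dots> = V.dim W"
    using B(4) card_image inj_on_subset[OF f(3)] by (metis subset_UNIV)
  finally show ?thesis .
qed

lemma complex_hom_iff:
  "T \<in> complex_hom P Q \<longleftrightarrow> (\<forall>x. blinfun_apply T (scaleC \<i> x) = scaleC \<i> (blinfun_apply T x)) \<and>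
     (\<forall>x. blinfun_apply T x \<in> Q) \<and> (\<forall>x\<in>Q. blinfun_apply T x = 0)"
proof -
  have "blinfun_apply T (scaleC c x) = scaleC c (blinfun_apply T x)"
    if "\<forall>x. blinfun_apply T (scaleC \<i> x) = scaleC \<i> (blinfun_apply T x)" for c x
    using that by (simp only: scaleC_eq[of c] blinfun.add_right blinfun.scaleR_right)
  then show ?thesis
    unfolding complex_hom_def by blast
qed

lemma complex_homD:
  assumes "T \<in> complex_hom P Q"
  shows "blinfun_apply T (scaleC \<i> x) = scaleC \<i> (blinfun_apply T x)"
    and "blinfun_apply T x \<in> Q" and "x \<in> Q \<Longrightarrow> blinfun_apply T x = 0"
  using assms unfolding complex_hom_iff by blast+

lemma complex_homI:
  assumes "\<And>x. blinfun_apply T (scaleC \<i> x) = scaleC \<i> (blinfun_apply T x)"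
    and "\<And>x. blinfun_apply T x \<in> Q" and "\<And>x. x \<in> Q \<Longrightarrow> blinfun_apply T x = 0"
  shows "T \<in> complex_hom P Q"
  using assms unfolding complex_hom_iff by blast

lemma subspace_complex_hom:
  fixes P :: "'a::euclidean_space complexification set"
  assumes "subspace Q"
  shows "subspace (complex_hom P Q)"
  using assms
  by (intro subspaceI complex_homI)
    (simp_all add: complex_homD blinfun.add_left blinfun.scaleR_left linear_add[OF linear_scaleC]
      linear_scale[OF linear_scaleC] linear_0[OF linear_scaleC] subspace_0 subspace_add subspace_scale)

text \<open>The defining conditions involve evaluation at fixed vectors, which is continuous, and
  \<open>Q\<close> is closed as a subspace of a finite-dimensional space.\<close>

lemma closed_complex_hom:
  fixes P :: "'a::euclidean_space complexification set"
  assumes "subspace Q"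
  shows "closed (complex_hom P Q)"
proof -
  have *: "closed {T :: 'a complexification \<Rightarrow>\<^sub>L 'a complexification. blinfun_apply T x \<in> Q}" for x
    using closed_vimage[OF closed_subspace[OF assms], of "\<lambda>T. blinfun_apply T x"]
    by (simp add: vimage_def linear_continuous_on blinfun.bounded_linear_left)
  have "complex_hom P Q = {T. (\<forall>c x. blinfun_apply T (scaleC c x) = scaleC c (blinfun_apply T x)) \<and>
         (\<forall>x. blinfun_apply T x \<in> Q) \<and> (\<forall>x. x \<in> Q \<longrightarrow> blinfun_apply T x = 0)}"
    unfolding complex_hom_def by blast
  also have "closed \<dots>"
    unfolding scaleC_def
    by (intro closed_Collect_conj closed_Collect_all closed_Collect_eq closed_Collect_imp * open_Collect_const)
       (intro continuous_intros linear_continuous_on blinfun.bounded_linear_left)+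
  finally show ?thesis .
qed

definition times_i :: "'a::euclidean_space complexification \<Rightarrow>\<^sub>L 'a complexification" where
  "times_i = Blinfun (scaleC \<i>)"

lemma times_i_apply: "blinfun_apply times_i x = scaleC \<i> x"
proof -
  have "bounded_linear (scaleC \<i> :: 'a complexification \<Rightarrow> _)"
    using linear_scaleC linear_conv_bounded_linear by blast
  then show ?thesis
    unfolding times_i_def by (simp add: bounded_linear_Blinfun_apply)
qed

lemma cstruct_grassmannian_chart:
  "cstruct (grassmannian_chart k P Q) T = times_i o\<^sub>L T"
proof -
  have "(\<lambda>x. scaleC \<i> (blinfun_apply T x)) = blinfun_apply (times_i o\<^sub>L T)"
    by (simp add: fun_eq_iff times_i_apply)
  then show ?thesis
    by (simp add: grassmannian_chart_def blinfun_apply_inverse)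
qed

section \<open>The atlas of the Grassmannian\<close>

context
  fixes k :: nat and P Q :: "'a::euclidean_space complexification set"
  assumes P: "P \<in> complex_grassmannian k" and Q: "module.subspace scaleC Q" and PQ: "complementary P Q"
begin

lemma P_subspace: "module.subspace scaleC P" "subspace P" and Q_subspace: "subspace Q"
  using P Q by (simp_all add: complex_grassmannian_def complex_subspace_iff)

lemma cdom_grassmannian_chart:
  "W \<in> cdom (grassmannian_chart k P Q) \<longleftrightarrow> W \<in> complex_grassmannian k \<and> complementary W Q"
  by (simp add: grassmannian_chart_def)

lemma cmodel_grassmannian_chart: "cmodel (grassmannian_chart k P Q) = complex_hom P Q"
  by (simp add: grassmannian_chart_def)

text \<open>Since \<open>T\<close> maps into \<open>Q\<close> and vanishes there, x + T x = 0 forces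
  x into \<open>Q\<close> and then x = 0. So 1 + T is an injective complex linear map and preserves
  the complex dimension.\<close>

lemma shear_in_grassmannian:
  assumes T: "T \<in> complex_hom P Q"
  shows "shear T P \<in> complex_grassmannian k"
proof -
  let ?f = "\<lambda>p. p + blinfun_apply T p"
  have lin: "linear ?f"
    by (intro linear_compose_add linear_ident bounded_linear.linear blinfun.bounded_linear_right)
  have cl: "?f (scaleC \<i> x) = scaleC \<i> (?f x)" for x
    by (simp add: complex_homD(1)[OF T] linear_add[OF linear_scaleC])
  have "x = 0" if "?f x = 0" for x
  proof -
    have "x = - blinfun_apply T x"
      using that by (simp add: eq_neg_iff_add_eq_0)
    moreover have "- blinfun_apply T x \<in> Q"
      by (intro subspace_neg Q_subspace complex_homD(2)[OF T])
    ultimately have "x \<in> Q"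
      by metis
    then show ?thesis
      using that complex_homD(3)[OF T] by simp
  qed
  then have "inj ?f"
    using linear_injective_0[OF lin] by blast
  from complex_dim_image[OF lin cl this P_subspace(1)]
  have "vector_space.dim scaleC (shear T P) = k"
    using P by (simp add: shear_def complex_grassmannian_def)
  moreover have "module.subspace scaleC (shear T P)"
    unfolding complex_subspace_iff
  proof
    show "subspace (shear T P)"
      unfolding shear_def by (rule linear_subspace_image[OF lin P_subspace(2)])
    show "\<forall>x\<in>shear T P. scaleC \<i> x \<in> shear T P"
      using P_subspace(1) by (auto simp: shear_def complex_subspace_iff cl[symmetric])
  qed
  ultimately show ?thesis
    by (simp add: complex_grassmannian_def)
qed

lemma shear_complementary:
  assumes T: "T \<in> complex_hom P Q"
  shows "complementary (shear T P) Q"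
proof -
  have "x = 0" if x: "x \<in> shear T P" "x \<in> Q" for x
  proof -
    obtain p where p: "p \<in> P" "x = p + blinfun_apply T p"
      using x by (auto simp: shear_def)
    then have "p = x - blinfun_apply T p"
      by simp
    moreover have "x - blinfun_apply T p \<in> Q"
      by (intro subspace_diff Q_subspace x(2) complex_homD(2)[OF T])
    ultimately have "p \<in> Q"
      by metis
    then have "p = 0"
      using PQ p by (auto simp: complementary_def)
    then show ?thesis
      using p by simp
  qed
  moreover have "0 \<in> shear T P" "0 \<in> Q"
    using subspace_0[OF P_subspace(2)] subspace_0[OF Q_subspace] by (force simp: shear_def)+
  moreover have "\<exists>p\<in>shear T P. \<exists>q\<in>Q. v = p + q" for v
  proof -
    obtain p q where "p \<in> P" "q \<in> Q" "v = p + q"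
      using PQ unfolding complementary_def by blast
    moreover from this have "v = (p + blinfun_apply T p) + (q - blinfun_apply T p)"
      "q - blinfun_apply T p \<in> Q"
      by (auto intro: subspace_diff Q_subspace complex_homD(2)[OF T])
    ultimately show ?thesis
      unfolding shear_def by blast
  qed
  ultimately show ?thesis
    unfolding complementary_def by blast
qed

text \<open>Uniqueness of the graph map: in p + T' p = p' + T p' the \<open>P\<close>-components
  agree, so p = p' and T' p = T p. On \<open>Q\<close> both maps vanish.\<close>

lemma cmap_shear:
  assumes T: "T \<in> complex_hom P Q"
  shows "cmap (grassmannian_chart k P Q) (shear T P) = T"
proof -
  have "(THE T'. T' \<in> complex_hom P Q \<and> shear T P = {p + blinfun_apply T' p | p. p \<in> P}) = T"
  proof (rule the_equality)
    show "T \<in> complex_hom P Q \<and> shear T P = {p + blinfun_apply T p | p. p \<in> P}"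
      using T by (auto simp: shear_def)
    fix T' assume T': "T' \<in> complex_hom P Q \<and> shear T P = {p + blinfun_apply T' p | p. p \<in> P}"
    have onP: "blinfun_apply T' p = blinfun_apply T p" if "p \<in> P" for p
    proof -
      have "p + blinfun_apply T' p \<in> shear T P"
        using T' that by blast
      then obtain p' where p': "p' \<in> P" "p + blinfun_apply T' p = p' + blinfun_apply T p'"
        by (auto simp: shear_def)
      have "(p + blinfun_apply T' p) - p \<in> Q"
        using complex_homD(2)[of T' P Q p] T' by simp
      moreover have "(p + blinfun_apply T' p) - p' \<in> Q"
        using complex_homD(2)[OF T, of p'] by (simp add: p'(2))
      ultimately have "p = p'"
        using complementary_unique[OF P_subspace(2) Q_subspace PQ] that p'(1) by blast
      then show ?thesis
        using p' by simp
    qed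
    show "T' = T"
    proof (rule blinfun_eqI)
      fix x
      obtain p q where "p \<in> P" "q \<in> Q" "x = p + q"
        using PQ unfolding complementary_def by blast
      then show "blinfun_apply T' x = blinfun_apply T x"
        using onP complex_homD(3)[OF T] complex_homD(3)[of T' P Q] T' by (simp add: blinfun.add_right)
    qed
  qed
  then show ?thesis
    by (simp add: grassmannian_chart_def)
qed

text \<open>The coordinate of \<open>W\<close> is the difference of the projections onto
  \<open>W\<close> and onto \<open>P\<close>, both along \<open>Q\<close>: it has values in
  \<open>Q\<close>, vanishes on \<open>Q\<close>, and sends p in \<open>P\<close> to \<pi> p - p
  with \<pi> the projection onto \<open>W\<close>, so that the graph point over p is \<pi> p. A
  formula that can be estimated thus replaces the definite description in the chart.\<close>

lemma grassmannian_chart_cases: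
  assumes W: "W \<in> cdom (grassmannian_chart k P Q)"
  shows "bproj W Q - bproj P Q \<in> complex_hom P Q" "W = shear (bproj W Q - bproj P Q) P"
proof -
  have cW: "module.subspace scaleC W" and WQ: "subspace W" "subspace Q" "complementary W Q"
    using W Q by (auto simp: cdom_grassmannian_chart complex_grassmannian_def complex_subspace_iff)
  note PQ' = P_subspace(2) Q_subspace PQ
  have app: "blinfun_apply (bproj W Q - bproj P Q) x = proj W Q x - proj P Q x" for x
    by (simp add: blinfun.diff_left bproj_apply[OF WQ] bproj_apply[OF PQ'])
  have inQ: "proj W Q x - proj P Q x \<in> Q" for x
    using subspace_diff[OF Q_subspace diff_proj_in[OF PQ'] diff_proj_in[OF WQ], of x x] by simp
  then show "bproj W Q - bproj P Q \<in> complex_hom P Q"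
    by (intro complex_homI; unfold app) (simp_all add: proj_scaleC[OF cW Q WQ(3)] proj_scaleC[OF P_subspace(1) Q PQ]
        linear_diff[OF linear_scaleC] proj_right[OF WQ] proj_right[OF PQ'])
  have "p + (proj W Q p - proj P Q p) \<in> W" if "p \<in> P" for p
    using that by (simp add: proj_left[OF PQ'] proj_in[OF WQ])
  moreover have "\<exists>p\<in>P. w = p + (proj W Q p - proj P Q p)" if "w \<in> W" for w
  proof
    have "- (w - proj P Q w) \<in> Q"
      by (intro subspace_neg Q_subspace diff_proj_in[OF PQ'])
    then have "proj W Q (proj P Q w) = w"
      using that by (intro proj_eqI[OF WQ]) auto
    then show "w = proj P Q w + (proj W Q (proj P Q w) - proj P Q (proj P Q w))"
      by (simp add: proj_left[OF PQ'] proj_in[OF PQ'])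
  qed (rule proj_in[OF PQ'])
  ultimately show "W = shear (bproj W Q - bproj P Q) P"
    unfolding shear_def app by blast
qed

lemma cmap_grassmannian_chart:
  assumes "W \<in> cdom (grassmannian_chart k P Q)"
  shows "cmap (grassmannian_chart k P Q) W = bproj W Q - bproj P Q"
  using grassmannian_chart_cases[OF assms] cmap_shear by metis

lemma shear_in_cdom: "T \<in> complex_hom P Q \<Longrightarrow> shear T P \<in> cdom (grassmannian_chart k P Q)"
  by (simp add: cdom_grassmannian_chart shear_in_grassmannian shear_complementary)

lemma shear_cmap:
  assumes "W \<in> cdom (grassmannian_chart k P Q)"
  shows "shear (cmap (grassmannian_chart k P Q) W) P = W" "cmap (grassmannian_chart k P Q) W \<in> complex_hom P Q"
  using cmap_grassmannian_chart[OF assms] grassmannian_chart_cases[OF assms] by simp_all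

lemma inj_on_cmap: "inj_on (cmap (grassmannian_chart k P Q)) (cdom (grassmannian_chart k P Q))"
  by (rule inj_on_inverseI[of _ "\<lambda>T. shear T P"]) (rule shear_cmap)

lemma complex_chart_grassmannian: "complex_chart (grassmannian_chart k P Q)"
proof -
  let ?c = "grassmannian_chart k P Q"
  have ii: "scaleC \<i> (scaleC \<i> x) = - x" for x :: "'a complexification"
    by (simp add: scaleC_i prod_eq_iff)
  have "complex_structure_on (complex_hom P Q) (cstruct ?c)"
    unfolding complex_structure_on_def cstruct_grassmannian_chart
    using subspace_complex_hom[OF Q_subspace] Q[unfolded complex_subspace_iff]
    by (auto simp: ii complex_homD times_i_apply linear_0[OF linear_scaleC]
        blinfun.bilinear_simps linear_add[OF linear_scaleC] linear_scale[OF linear_scaleC]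
        simp del: split_paired_All intro!: blinfun_eqI complex_homI)
  moreover have "cmap ?c ` cdom ?c = complex_hom P Q"
    using shear_cmap(2) cmap_shear shear_in_cdom by (force simp: image_iff)
  ultimately show ?thesis
    by (simp add: complex_chart_def cmodel_grassmannian_chart inj_on_cmap)
qed

text \<open>Homomorphisms vanish on \<open>Q\<close>, so one may pass from \<open>P\<close> to another complement as base point.\<close>

lemma shear_rebase:
  assumes "T0 \<in> complex_hom P Q" "T \<in> complex_hom P Q"
  shows "shear T P = shear (T - T0) (shear T0 P)"
proof -
  have "blinfun_apply (T - T0) (p + blinfun_apply T0 p) = blinfun_apply T p - blinfun_apply T0 p" for p
    using complex_homD(3)[OF assms(1) complex_homD(2)[OF assms(1)]]
      complex_homD(3)[OF assms(2) complex_homD(2)[OF assms(1)]] by (simp add: blinfun.bilinear_simps)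
  then show ?thesis
    unfolding shear_def image_image by (simp add: algebra_simps)
qed

text \<open>At a point \<open>W0\<close> of the set the base is moved from \<open>P\<close> to
  \<open>W0\<close>. A nearby \<open>T\<close> then gives the shear of \<open>W0\<close> by the
  small map \<open>T - T0\<close>, and small shears keep the complement \<open>R\<close>.\<close>

lemma openin_complementary:
  assumes R: "subspace R"
  shows "openin (top_of_set (complex_hom P Q))
    (cmap (grassmannian_chart k P Q) ` {W \<in> cdom (grassmannian_chart k P Q). complementary W R})"
    (is "openin _ (cmap ?c ` ?D)")
  unfolding openin_euclidean_subtopology_iff
proof (intro conjI ballI)
  show "cmap ?c ` ?D \<subseteq> complex_hom P Q"
    using shear_cmap(2) by auto
  fix T0 assume "T0 \<in> cmap ?c ` ?D"
  then obtain W0 where W0: "W0 \<in> cdom ?c" "complementary W0 R" "T0 = cmap ?c W0"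
    by auto
  then have T0: "T0 \<in> complex_hom P Q" "shear T0 P = W0" "subspace W0"
    using shear_cmap by (auto simp: cdom_grassmannian_chart complex_grassmannian_def complex_subspace_iff)
  define e where "e = 1 / (norm (bproj W0 R) + 1)"
  have "e > 0"
    by (simp add: e_def add_nonneg_pos)
  moreover have "T \<in> cmap ?c ` ?D" if T: "T \<in> complex_hom P Q" "dist T T0 < e" for T
  proof -
    have "norm (T - T0) * (norm (bproj W0 R) + 1) < 1"
      using T(2) by (simp add: e_def dist_norm pos_less_divide_eq add_nonneg_pos)
    then have "norm (T - T0) * norm (bproj W0 R) < 1"
      using norm_ge_zero[of "T - T0"] unfolding distrib_left by linarith
    then have "norm ((T - T0) o\<^sub>L bproj W0 R) < 1"
      using norm_blinfun_compose order_le_less_trans by blast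
    from complementary_shear[OF T0(3) R W0(2) this]
    have "complementary (shear T P) R"
      using shear_rebase[OF T0(1) T(1)] T0(2) by simp
    then show ?thesis
      using shear_in_cdom[OF T(1)] cmap_shear[OF T(1)] by (auto simp: image_iff intro!: exI[of _ "shear T P"])
  qed
  ultimately show "\<exists>e>0. \<forall>T\<in>complex_hom P Q. dist T T0 < e \<longrightarrow> T \<in> cmap ?c ` ?D"
    by blast
qed

end

text \<open>Let \<pi> and \<pi>' be the projections along \<open>R\<close> onto \<open>W\<close> and
  onto its shear. As \<pi> x + H \<pi> x lies in the shear and x - \<pi> x in \<open>R\<close>,
  \<pi>' (x + H \<pi> x) = \<pi> x + H \<pi> x. Hence r = \<pi>' - \<pi> satisfies r = (H \<pi> -
  \<pi> H \<pi>) - r H \<pi>, an exact identity whose last term is of second order in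
  \<open>H\<close>.\<close>

lemma proj_shear_expansion:
  fixes W R :: "'v::euclidean_space set"
  assumes WR: "subspace W" "subspace R" "complementary W R"
    and S: "subspace (shear H W)" "complementary (shear H W) R"
  shows "bproj (shear H W) R - bproj W R =
    ((H o\<^sub>L bproj W R) - (bproj W R o\<^sub>L H o\<^sub>L bproj W R))
    - ((bproj (shear H W) R - bproj W R) o\<^sub>L (H o\<^sub>L bproj W R))"
proof (rule blinfun_eqI)
  fix x
  let ?\<pi> = "proj W R" and ?\<pi>' = "proj (shear H W) R"
  note SR = S(1) WR(2) S(2)
  let ?w = "?\<pi> x"
  have "?w + blinfun_apply H ?w \<in> shear H W"
    using proj_in[OF WR] by (auto simp: shear_def)
  then have "?\<pi>' (x + blinfun_apply H ?w) = ?w + blinfun_apply H ?w"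
    using diff_proj_in[OF WR, of x] by (intro proj_eqI[OF SR]) auto
  then have "?\<pi>' x + ?\<pi>' (blinfun_apply H ?w) = ?w + blinfun_apply H ?w"
    by (simp add: linear_add[OF linear_proj[OF SR]])
  then have "?\<pi>' x = ?w + blinfun_apply H ?w - ?\<pi>' (blinfun_apply H ?w)"
    by (simp add: eq_diff_eq)
  then show "blinfun_apply (bproj (shear H W) R - bproj W R) x =
      blinfun_apply (((H o\<^sub>L bproj W R) - (bproj W R o\<^sub>L H o\<^sub>L bproj W R))
        - ((bproj (shear H W) R - bproj W R) o\<^sub>L (H o\<^sub>L bproj W R))) x"
    by (simp add: blinfun.diff_left bproj_apply[OF WR] bproj_apply[OF SR])
qed

text \<open>With D = H \<pi> - \<pi> H \<pi> the identity r = D - r H \<pi> is used twice: smallness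
  of \<open>H\<close> gives norm r \<le> norm D + norm r / 2, so r is of first order in
  \<open>H\<close>; then r - D = - r H \<pi> is of second order.\<close>

lemma norm_proj_shear:
  fixes W R :: "'v::euclidean_space set"
  assumes "subspace W" "subspace R" "complementary W R"
    and S: "subspace (shear H W)" "complementary (shear H W) R"
    and H: "norm H * norm (bproj W R) \<le> 1 / 2"
  shows "norm (bproj (shear H W) R - bproj W R - ((H o\<^sub>L bproj W R) - (bproj W R o\<^sub>L H o\<^sub>L bproj W R)))
    \<le> 2 * (1 + norm (bproj W R)) * (norm (bproj W R))\<^sup>2 * (norm H)\<^sup>2"
proof -
  let ?\<pi> = "bproj W R"
  define r where "r = bproj (shear H W) R - ?\<pi>"
  define D where "D = (H o\<^sub>L ?\<pi>) - (?\<pi> o\<^sub>L H o\<^sub>L ?\<pi>)"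
  have r: "r = D - (r o\<^sub>L (H o\<^sub>L ?\<pi>))"
    unfolding r_def D_def by (rule proj_shear_expansion[OF assms(1-5)])
  have assoc: "?\<pi> o\<^sub>L H o\<^sub>L ?\<pi> = ?\<pi> o\<^sub>L (H o\<^sub>L ?\<pi>)"
    by (rule blinfun_eqI) simp
  have H\<pi>: "norm (H o\<^sub>L ?\<pi>) \<le> norm H * norm ?\<pi>"
    by (rule norm_blinfun_compose)
  have rest: "norm (r o\<^sub>L (H o\<^sub>L ?\<pi>)) \<le> norm r * (norm H * norm ?\<pi>)"
    using norm_blinfun_compose[of r "H o\<^sub>L ?\<pi>"] mult_left_mono[OF H\<pi>, of "norm r"] by simp
  have "norm (?\<pi> o\<^sub>L H o\<^sub>L ?\<pi>) \<le> norm ?\<pi> * (norm H * norm ?\<pi>)"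
    using norm_blinfun_compose[of ?\<pi> "H o\<^sub>L ?\<pi>"] mult_left_mono[OF H\<pi>, of "norm ?\<pi>"]
    by (simp add: assoc)
  then have D: "norm D \<le> (1 + norm ?\<pi>) * (norm H * norm ?\<pi>)"
    unfolding D_def using norm_triangle_ineq4[of "H o\<^sub>L ?\<pi>" "?\<pi> o\<^sub>L H o\<^sub>L ?\<pi>"] H\<pi>
    by (simp add: distrib_right)
  have "norm r \<le> norm D + norm (r o\<^sub>L (H o\<^sub>L ?\<pi>))"
    using norm_triangle_ineq4[of D "r o\<^sub>L (H o\<^sub>L ?\<pi>)"] r by simp
  also have "\<dots> \<le> norm D + norm r * (1 / 2)"
    using rest mult_left_mono[OF H, of "norm r"] by simp
  finally have "norm r \<le> 2 * ((1 + norm ?\<pi>) * (norm H * norm ?\<pi>))"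
    using D by simp
  then have "norm r * (norm H * norm ?\<pi>) \<le>
      2 * ((1 + norm ?\<pi>) * (norm H * norm ?\<pi>)) * (norm H * norm ?\<pi>)"
    by (intro mult_right_mono) auto
  moreover have "r - D = - (r o\<^sub>L (H o\<^sub>L ?\<pi>))"
    by (subst r) simp
  then have "norm (r - D) \<le> norm r * (norm H * norm ?\<pi>)"
    using rest by simp
  ultimately show ?thesis
    unfolding r_def[symmetric] D_def[symmetric] by (simp add: power2_eq_square algebra_simps)
qed

text \<open>The coordinate change sends \<open>T\<close>, with graph W, to the difference of the
  projections onto W and onto P' along Q'. Its derivative at the graph \<open>W0\<close> is H |-> H
  \<pi> - \<pi> H \<pi>, where \<pi> projects onto \<open>W0\<close> along Q'; it is complex linear
  because \<pi> commutes with \<i>.\<close>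

lemma compatible_grassmannian_charts:
  fixes P :: "'a::euclidean_space complexification set"
  assumes c: "P \<in> complex_grassmannian k" "module.subspace scaleC Q" "complementary P Q"
    and d: "P' \<in> complex_grassmannian k" "module.subspace scaleC Q'" "complementary P' Q'"
  shows "holo_in_charts (grassmannian_chart k P Q) (grassmannian_chart k P' Q') (\<lambda>W. W)"
proof -
  let ?c = "grassmannian_chart k P Q" and ?d = "grassmannian_chart k P' Q'"
  define \<Omega> where "\<Omega> = cmap ?c ` {W \<in> cdom ?c. W \<in> cdom ?d}"
  define tr where "tr = (\<lambda>T. cmap ?d (inv_into (cdom ?c) (cmap ?c) T))"
  have Q': "subspace Q'"
    using d by (simp add: complex_subspace_iff)
  have "{W \<in> cdom ?c. W \<in> cdom ?d} = {W \<in> cdom ?c. complementary W Q'}"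
    using cdom_grassmannian_chart[OF c] cdom_grassmannian_chart[OF d] by blast
  then have "openin (top_of_set (cmodel ?c)) \<Omega>"
    using openin_complementary[OF c Q'] cmodel_grassmannian_chart[OF c] by (simp add: \<Omega>_def)
  moreover have "\<exists>D. (tr has_derivative D) (at T0 within \<Omega>) \<and>
      (\<forall>v\<in>cmodel ?c. D (cstruct ?c v) = cstruct ?d (D v))" if T0: "T0 \<in> \<Omega>" for T0
  proof -
    obtain W0 where W0: "W0 \<in> cdom ?c" "W0 \<in> cdom ?d" "T0 = cmap ?c W0"
      using T0 by (auto simp: \<Omega>_def)
    have T0: "T0 \<in> complex_hom P Q" "shear T0 P = W0"
      using W0 shear_cmap[OF c] by auto
    have cW0: "module.subspace scaleC W0" and W0Q': "subspace W0" "subspace Q'" "complementary W0 Q'"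
      using W0(2) Q' unfolding cdom_grassmannian_chart[OF d]
      by (auto simp: complex_grassmannian_def complex_subspace_iff)
    define \<pi> where "\<pi> = bproj W0 Q'"
    define D where "D = (\<lambda>H. (H o\<^sub>L \<pi>) - (\<pi> o\<^sub>L H o\<^sub>L \<pi>))"
    have "D = (\<lambda>H. (H o\<^sub>L \<pi>) - (\<pi> o\<^sub>L (H o\<^sub>L \<pi>)))"
      unfolding D_def by (intro ext blinfun_eqI) (simp add: blinfun.diff_left)
    moreover have "bounded_linear \<dots>"
      by (intro bounded_linear_sub bounded_linear_compose[OF
          bounded_bilinear.bounded_linear_right[OF bounded_bilinear_blinfun_compose]]
          bounded_bilinear.bounded_linear_left[OF bounded_bilinear_blinfun_compose])
    ultimately have "bounded_linear D"
      by simp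
    \<comment> \<open>The factor 2 secures \<open>norm (T - T0) * norm \<pi> \<le> 1 / 2\<close>,
      the smallness required by \<open>norm_proj_shear\<close>.\<close>
    define e where "e = 1 / (2 * (norm \<pi> + 1))"
    have "e > 0"
      by (simp add: e_def add_nonneg_pos)
    have trT: "tr (cmap ?c W) = bproj W Q' - bproj P' Q'" if "W \<in> cdom ?c" "W \<in> cdom ?d" for W
      using that inj_on_cmap[OF c] cmap_grassmannian_chart[OF d] by (simp add: tr_def)
    have "(tr has_derivative D) (at T0 within \<Omega>)"
    proof (rule has_derivative_quadratic[OF \<open>bounded_linear D\<close> \<open>e > 0\<close>])
      fix T assume "T \<in> \<Omega>" and Te: "norm (T - T0) < e"
      then obtain W where W: "W \<in> cdom ?c" "W \<in> cdom ?d" "T = cmap ?c W"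
        by (auto simp: \<Omega>_def)
      then have T: "T \<in> complex_hom P Q" "shear T P = W"
        using shear_cmap[OF c] by auto
      then have WT: "W = shear (T - T0) W0"
        using shear_rebase[OF c T0(1) T(1)] T0(2) by simp
      have S: "subspace W" "complementary W Q'"
        using W(2) unfolding cdom_grassmannian_chart[OF d]
        by (auto simp: complex_grassmannian_def complex_subspace_iff)
      have "norm (T - T0) * (2 * (norm \<pi> + 1)) \<le> 1"
        using Te by (simp add: e_def pos_less_divide_eq add_nonneg_pos less_imp_le)
      then have "norm (T - T0) * norm \<pi> \<le> 1 / 2"
        using norm_ge_zero[of "T - T0"] unfolding distrib_left by linarith
      from norm_proj_shear[OF W0Q' S[unfolded WT] this[unfolded \<pi>_def]]
      have "norm (bproj W Q' - \<pi> - D (T - T0)) \<le> 2 * (1 + norm \<pi>) * (norm \<pi>)\<^sup>2 * (norm (T - T0))\<^sup>2"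
        unfolding WT[symmetric] \<pi>_def[symmetric] D_def .
      moreover have "tr T - tr T0 = bproj W Q' - \<pi>"
        using trT W W0 by (simp add: \<pi>_def)
      ultimately show "norm (tr T - tr T0 - D (T - T0)) \<le>
          2 * (1 + norm \<pi>) * (norm \<pi>)\<^sup>2 * (norm (T - T0))\<^sup>2"
        by simp
    qed
    moreover have "D (cstruct ?c v) = cstruct ?d (D v)" for v
      unfolding D_def cstruct_grassmannian_chart
      by (rule blinfun_eqI) (simp add: blinfun.diff_left times_i_apply linear_diff[OF linear_scaleC]
          \<pi>_def bproj_apply[OF W0Q'] proj_scaleC[OF cW0 d(2) W0Q'(3)])
    ultimately show ?thesis
      by blast
  qed
  ultimately show ?thesis
    unfolding holo_in_charts_def holo_on_def Let_def \<Omega>_def tr_def by blast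
qed

lemma complex_atlas_grassmannian:
  "complex_atlas (grassmannian_atlas k :: ('a::euclidean_space complexification set, _) cchart set)"
  unfolding complex_atlas_def compatible_charts_def
  by (auto simp: grassmannian_atlas_def intro!: complex_chart_grassmannian compatible_grassmannian_charts)

lemma closed_cmodel_grassmannian:
  "d \<in> grassmannian_atlas k \<Longrightarrow> closed (cmodel d)"
  for d :: "('a::euclidean_space complexification set, _) cchart"
  by (auto simp: grassmannian_atlas_def grassmannian_chart_def complex_subspace_iff
      intro!: closed_complex_hom)

section \<open>Compatibility of the holomorphic charts\<close>

text \<open>The derivatives D of \<open>c\<close> at a point and E of its inverse are mutually
  inverse between tangent space and model. So E inherits complex linearity from D, and D' E is a
  complex linear derivative of the coordinate change.\<close>

lemma holomorphic_charts_compatible: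
  fixes c c' :: "('a::{real_algebra_1, euclidean_space}, 'a) cchart"
  assumes c: "c \<in> holomorphic_charts imaginary_units (*)"
    and c': "c' \<in> holomorphic_charts imaginary_units (*)"
  shows "holo_in_charts c c' (\<lambda>x. x)"
proof -
  let ?S = "imaginary_units :: 'a set"
  obtain \<psi> where chart: "complex_chart c" and opn: "openin (top_of_set ?S) (cdom c)"
    and homeo: "homeomorphism (cdom c) (cmap c ` cdom c) (cmap c) \<psi>"
    and smooth: "smooth_on (cmap c ` cdom c) \<psi>"
    using c by (auto simp: holomorphic_charts_def diffeomorphism_def)
  have opn': "openin (top_of_set ?S) (cdom c')"
    using c' by (auto simp: holomorphic_charts_def)
  have sub: "cdom c \<subseteq> ?S" "cdom c' \<subseteq> ?S"
    using opn opn' openin_imp_subset by blast+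
  have \<psi>: "\<psi> (cmap c x) = x" if "x \<in> cdom c" for x
    using homeo that by (simp add: homeomorphism_def)
  define W where "W = cmap c ` {x \<in> cdom c. x \<in> cdom c'}"
  define V where "V = cmap c ` cdom c"
  have "openin (top_of_set (cdom c)) {x \<in> cdom c. x \<in> cdom c'}"
    using opn' sub by (auto simp: openin_open)
  then have "openin (top_of_set V) W"
    unfolding V_def W_def by (rule homeomorphism_imp_open_map[OF homeo])
  moreover have V: "openin (top_of_set (cmodel c)) V"
    unfolding V_def by (rule complex_chart_simps(3)[OF chart])
  ultimately have W: "openin (top_of_set (cmodel c)) W"
    by (rule openin_trans)
  have WV: "W \<subseteq> V"
    by (auto simp: W_def V_def)
  have "\<exists>\<Delta>. ((\<lambda>z. cmap c' (inv_into (cdom c) (cmap c) z)) has_derivative \<Delta>) (at (cmap c p) within W) \<and>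
      (\<forall>v\<in>cmodel c. \<Delta> (cstruct c v) = cstruct c' (\<Delta> v))"
    if p: "p \<in> cdom c" "p \<in> cdom c'" for p
  proof -
    let ?z = "cmap c p"
    have zV: "?z \<in> V" and zW: "?z \<in> W" and pS: "p \<in> ?S"
      using p sub by (auto simp: V_def W_def)
    note T = tangent_space_imaginary_units[OF pS]
    obtain D where D: "(cmap c has_derivative D) (at p within ?S)"
      "\<And>v. v \<in> anticommutant p \<Longrightarrow> D (p * v) = cstruct c (D v)"
      using c p(1) unfolding holomorphic_charts_def T[symmetric] by blast
    obtain D' where D': "(cmap c' has_derivative D') (at p within ?S)"
      "\<And>v. v \<in> anticommutant p \<Longrightarrow> D' (p * v) = cstruct c' (D' v)"
      using c' p(2) unfolding holomorphic_charts_def T[symmetric] by blast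
    obtain E where E: "(\<psi> has_derivative E) (at ?z within V)"
      using smooth_on_has_derivative[OF smooth zV[unfolded V_def]] unfolding V_def by blast
    have \<psi>V: "\<psi> ` V \<subseteq> ?S"
      using \<psi> sub by (auto simp: V_def)
    \<comment> \<open>Along the model a function that vanishes on \<open>V\<close> has zero
      derivative; identities between maps on \<open>V\<close> are differentiated in this
      way.\<close>
    have line: "f' v = 0" if "(f has_derivative f') (at ?z within V)" "\<And>y. y \<in> V \<Longrightarrow> f y = 0" "v \<in> cmodel c"
      for f :: "'a \<Rightarrow> 'a" and f' v
      using has_derivative_in_closed_subspace[OF that(1) V zV complex_chart_simps(1)[OF chart] that(3), of "{0}"]
        that(2) by (auto simp: subspace_def)
    have ET: "E v \<in> anticommutant p" if v: "v \<in> cmodel c" for v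
    proof -
      have "((\<lambda>y. \<psi> y * \<psi> y + 1) has_derivative (\<lambda>h. (\<psi> ?z * E h + E h * \<psi> ?z) + 0)) (at ?z within V)"
        by (intro has_derivative_add bounded_bilinear.FDERIV[OF bounded_bilinear_times] E
            has_derivative_const)
      from line[OF this _ v] have "\<psi> ?z * E v + E v * \<psi> ?z = 0"
        using \<psi>V by (simp add: image_subset_iff imaginary_units_iff)
      then show ?thesis
        by (simp add: \<psi> p(1) anticommutant_def)
    qed
    have DE: "D (E v) = v" if v: "v \<in> cmodel c" for v
    proof -
      have "(cmap c has_derivative D) (at (\<psi> ?z) within \<psi> ` V)"
        using has_derivative_subset[OF D(1) \<psi>V] \<psi> p(1) by simp
      then have "((cmap c \<circ> \<psi>) has_derivative (D \<circ> E)) (at ?z within V)"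
        by (rule diff_chain_within[OF E])
      then have "((\<lambda>y. (cmap c \<circ> \<psi>) y - y) has_derivative (\<lambda>h. (D \<circ> E) h - h)) (at ?z within V)"
        by (rule has_derivative_diff) (rule has_derivative_ident)
      moreover have "(cmap c \<circ> \<psi>) y - y = 0" if "y \<in> V" for y
        using that \<psi> by (auto simp: V_def)
      ultimately have "(D \<circ> E) v - v = 0"
        using v by (rule line)
      then show ?thesis
        by simp
    qed
    have ED: "E (D u) = u" if u: "u \<in> anticommutant p" for u
    proof -
      \<comment> \<open>A tangent vector is given as the velocity of a curve in the units; the
        identity that \<psi> after the chart fixes this curve is differentiated at 0.\<close>
      obtain \<gamma> :: "real \<Rightarrow> 'a" and \<epsilon> where \<gamma>: "\<epsilon> > 0" "smooth_on {-\<epsilon><..<\<epsilon>} \<gamma>"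
        "\<gamma> ` {-\<epsilon><..<\<epsilon>} \<subseteq> ?S" "\<gamma> 0 = p" "(\<gamma> has_vector_derivative u) (at 0)"
        using u unfolding T[symmetric] tangent_space_def by blast
      have "continuous_on {-\<epsilon><..<\<epsilon>} \<gamma>"
        unfolding continuous_on_eq_continuous_within
        using smooth_on_has_derivative[OF \<gamma>(2)] has_derivative_continuous by metis
      then have "openin (top_of_set {-\<epsilon><..<\<epsilon>}) ({-\<epsilon><..<\<epsilon>} \<inter> \<gamma> -` cdom c)"
        using \<gamma>(3) opn by (intro continuous_openin_preimage[where T = ?S]) auto
      then have opT: "open ({-\<epsilon><..<\<epsilon>} \<inter> \<gamma> -` cdom c)" (is "open ?T")
        using openin_open_trans[OF _ open_greaterThanLessThan] by blast
      have 0: "0 \<in> ?T"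
        using \<gamma> p by simp
      have g: "(\<gamma> has_derivative (\<lambda>t. t *\<^sub>R u)) (at 0 within ?T)"
        using \<gamma>(5) has_derivative_at_withinI unfolding has_vector_derivative_def by blast
      have "(cmap c has_derivative D) (at (\<gamma> 0) within \<gamma> ` ?T)"
        using has_derivative_subset[OF D(1), of "\<gamma> ` ?T"] \<gamma>(3,4) by blast
      from diff_chain_within[OF g this]
      have g2: "((cmap c \<circ> \<gamma>) has_derivative (D \<circ> (\<lambda>t. t *\<^sub>R u))) (at 0 within ?T)" .
      have "(\<psi> has_derivative E) (at ((cmap c \<circ> \<gamma>) 0) within (cmap c \<circ> \<gamma>) ` ?T)"
        using has_derivative_subset[OF E, of "(cmap c \<circ> \<gamma>) ` ?T"] \<gamma>(4) by (auto simp: V_def)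
      from has_derivative_diff[OF diff_chain_within[OF g2 this] g]
      have "((\<lambda>t. (\<psi> \<circ> (cmap c \<circ> \<gamma>)) t - \<gamma> t) has_derivative
          (\<lambda>t. (E \<circ> (D \<circ> (\<lambda>t. t *\<^sub>R u))) t - t *\<^sub>R u)) (at 0 within ?T)" .
      from has_derivative_in_closed_subspace[OF this _ 0, of UNIV 1 "{0}"]
      show ?thesis
        using opT \<psi> by (auto simp: subspace_def)
    qed
    have "(cmap c' has_derivative D') (at (\<psi> ?z) within \<psi> ` W)"
      using has_derivative_subset[OF D'(1), of "\<psi> ` W"] WV \<psi>V \<psi> p(1) by auto
    from diff_chain_within[OF has_derivative_subset[OF E WV] this]
    have "((cmap c' \<circ> \<psi>) has_derivative (D' \<circ> E)) (at ?z within W)" .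
    then have "((\<lambda>z. cmap c' (inv_into (cdom c) (cmap c) z)) has_derivative (D' \<circ> E)) (at ?z within W)"
      using zW
      by (rule has_derivative_transform[rotated 2])
        (use \<psi> complex_chart_simps(2)[OF chart] in \<open>auto simp: W_def\<close>)
    moreover have "(D' \<circ> E) (cstruct c v) = cstruct c' ((D' \<circ> E) v)" if v: "v \<in> cmodel c" for v
    proof -
      \<comment> \<open>Writing v = D (E v), complex linearity of D moves the structure of the model
        to p, and p E v is again tangent, so E and D cancel on it.\<close>
      have "E (cstruct c v) = E (D (p * E v))"
        using D(2)[OF ET[OF v]] DE[OF v] by simp
      also have "\<dots> = p * E v"
        by (rule ED[OF times_anticommutant[OF pS ET[OF v]]])
      finally show ?thesis
        using D'(2)[OF ET[OF v]] by simp
    qed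
    ultimately show ?thesis
      by blast
  qed
  then show ?thesis
    using W unfolding holo_in_charts_def holo_on_def Let_def W_def by blast
qed

section \<open>Eigenspaces of left multiplications\<close>

definition eigenspace :: "'a::real_algebra_1 \<Rightarrow> 'a complexification set" where
  "eigenspace s = \<W> (\<lambda>x. s * x)"

lemma eigenspace_times: "eigenspace s = range (\<lambda>v. (v, s * v))"
  for s :: "'a::real_algebra_1"
  by (auto simp: eigenspace_def \<W>_def ctensor_def)

text \<open>Adjoining a vector x to a complex independent set enlarges the real dimension of its
  complex span by two, through x and \<i> x.\<close>

lemma real_dim_complex_subspace:
  fixes W :: "'a::euclidean_space complexification set"
  assumes W: "module.subspace scaleC W"
  shows "dim W = 2 * vector_space.dim scaleC W"
proof -
  interpret V: vector_space "scaleC :: complex \<Rightarrow> 'a \<times> 'a \<Rightarrow> 'a \<times> 'a"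
    by (rule vector_space_scaleC)
  have span: "subspace (V.span B)" "\<And>x. x \<in> V.span B \<Longrightarrow> scaleC c x \<in> V.span B" for B c
    using V.subspace_span[of B] V.span_scale unfolding complex_subspace_iff by blast+
  have dim_span: "dim (V.span B) = 2 * card B" if "finite B" "V.independent B" for B
    using that
  proof (induction B rule: finite_induct)
    case (insert x B)
    let ?V = "V.span B"
    have x: "x \<notin> ?V" and ind: "V.independent B"
      using insert.prems insert.hyps by (auto simp: V.independent_insert)
    have spanV: "span ?V = ?V"
      using span(1) by (simp add: span_eq_iff)
    \<comment> \<open>A real relation would put (\<i> - r) x into the complex span for some real r;
      as \<i> - r is invertible, \<open>x\<close> would belong to it.\<close>
    have ix: "scaleC \<i> x \<notin> span (insert x ?V)"
    proof
      assume "scaleC \<i> x \<in> span (insert x ?V)"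
      then obtain r where "scaleC \<i> x - r *\<^sub>R x \<in> ?V"
        using spanV by (auto simp: span_insert)
      moreover have "scaleC \<i> x - r *\<^sub>R x = scaleC (\<i> - of_real r) x"
        by (simp add: scaleC_def prod_eq_iff)
      ultimately have "scaleC (\<i> - of_real r) x \<in> ?V"
        by (simp only:)
      then have "scaleC (1 / (\<i> - of_real r)) (scaleC (\<i> - of_real r) x) \<in> ?V"
        by (rule span(2))
      moreover have "\<i> \<noteq> of_real r"
        by (simp add: complex_eq_iff)
      ultimately show False
        using x by simp
    qed
    have "V.span (insert x B) = span (insert (scaleC \<i> x) (insert x ?V))"
    proof (intro equalityI subsetI)
      fix y assume "y \<in> V.span (insert x B)"
      then obtain k where "y - scaleC k x \<in> ?V"
        by (auto simp: V.span_insert)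
      then have "y - Im k *\<^sub>R scaleC \<i> x - Re k *\<^sub>R x \<in> span ?V"
        unfolding spanV by (subst (asm) scaleC_eq) (simp add: algebra_simps)
      then show "y \<in> span (insert (scaleC \<i> x) (insert x ?V))"
        by (auto simp: span_insert[of "scaleC \<i> x"] span_insert[of x])
    next
      have "insert (scaleC \<i> x) (insert x ?V) \<subseteq> V.span (insert x B)"
        using V.span_base[of x "insert x B"] V.span_mono[of B "insert x B"]
        by (auto intro: V.span_scale)
      then show "y \<in> V.span (insert x B)" if "y \<in> span (insert (scaleC \<i> x) (insert x ?V))" for y
        using that span_minimal[OF _ span(1)] by blast
    qed
    moreover have "x \<notin> span ?V"
      using x spanV by (simp only:) simp
    ultimately have "dim (V.span (insert x B)) = dim ?V + 2"
      using ix by (simp add: dim_insert)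
    then show ?case
      using insert.IH[OF ind] insert.hyps by simp
  qed simp
  have rW: "subspace W"
    using W by (simp add: complex_subspace_iff)
  \<comment> \<open>Choosing the complex basis \<open>B\<close> inside a real basis makes it
    finite.\<close>
  obtain C where C: "C \<subseteq> W" "independent C" "W \<subseteq> span C"
    using basis_exists by metis
  obtain B where B: "B \<subseteq> C" "V.independent B" "C \<subseteq> V.span B"
    using V.maximal_independent_subset by blast
  have "finite B"
    using finite_subset[OF B(1)] C(2) finiteI_independent by blast
  moreover have WB: "W = V.span B"
  proof
    show "W \<subseteq> V.span B"
      using C(3) span_minimal[OF B(3) span(1)] by blast
    show "V.span B \<subseteq> W"
      using B(1) C(1) W by (intro V.span_minimal) auto
  qed
  ultimately show ?thesis
    using dim_span[OF _ B(2)] V.dim_eq_card[OF _ B(2), of W] V.span_span by metis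
qed

context
  fixes s :: "'a::{real_algebra_1, euclidean_space}"
  assumes s: "s \<in> imaginary_units"
begin

text \<open>The map v |-> (v, s v) is a real isomorphism of the algebra onto the eigenspace. The
  real dimension of the latter is twice its complex one, so \<open>DIM('a)\<close> is even here and
  \<open>div 2\<close> is exact.\<close>

lemma eigenspace_in_grassmannian: "eigenspace s \<in> complex_grassmannian (DIM('a) div 2)"
proof -
  let ?f = "\<lambda>v :: 'a. (v, s * v)"
  have lin: "linear ?f"
    by (auto intro!: linearI simp: algebra_simps)
  have "scaleC \<i> (v, s * v) = ?f (- (s * v))" for v
    by (simp add: scaleC_i imaginary_unit_cancel[OF s])
  then have sub: "module.subspace scaleC (eigenspace s)"
    unfolding complex_subspace_iff eigenspace_times
    using linear_subspace_image[OF lin subspace_UNIV] by auto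
  have "dim (eigenspace s) = DIM('a)"
    unfolding eigenspace_times using dim_image_eq[OF lin, of UNIV] by (simp add: inj_on_def)
  then show ?thesis
    using real_dim_complex_subspace[OF sub] sub by (simp add: complex_grassmannian_def)
qed

lemma eigenspaces_complementary: "complementary (eigenspace s) (eigenspace (- s))"
proof -
  have "z = 0" if z: "z \<in> eigenspace s" "z \<in> eigenspace (- s)" for z
  proof -
    obtain v where v: "z = (v, s * v)" "z = (v, - (s * v))"
      using z by (auto simp: eigenspace_times)
    then have "s * v = - (s * v)"
      by simp
    then have "s * v + s * v = 0"
      by (metis add.left_inverse)
    then have "s * v = 0"
      by (simp flip: scaleR_2)
    then have "s * (s * v) = 0"
      by simp
    then show ?thesis
      by (simp add: imaginary_unit_cancel[OF s] v(1) zero_prod_def)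
  qed
  moreover have "0 \<in> eigenspace s" "0 \<in> eigenspace (- s)"
    by (auto simp: eigenspace_times zero_prod_def image_iff)
  ultimately have "eigenspace s \<inter> eigenspace (- s) = {0}"
    by blast
  moreover have "\<exists>p\<in>eigenspace s. \<exists>q\<in>eigenspace (- s). x = p + q" for x
  proof (intro bexI)
    \<comment> \<open>With a and b the entries of \<open>x\<close>, the equations v + u = a and s v
      - s u = b give v = (a - s b) / 2 and u = (a + s b) / 2.\<close>
    let ?v = "(1 / 2) *\<^sub>R (fst x - s * snd x)" and ?u = "(1 / 2) *\<^sub>R (fst x + s * snd x)"
    show "x = (?v, s * ?v) + (?u, - s * ?u)"
      by (simp add: prod_eq_iff algebra_simps imaginary_unit_cancel[OF s] flip: scaleR_add_left)
  qed (unfold eigenspace_times, rule rangeI, rule rangeI)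
  ultimately show ?thesis
    unfolding complementary_def by simp
qed

lemma eigenspace_complementary_imaginary: "complementary (eigenspace s) ({0} \<times> UNIV)"
proof -
  have "\<exists>p\<in>range (\<lambda>v. (v, s * v)). \<exists>q\<in>{0} \<times> UNIV. x = p + q" for x
    by (intro bexI[of _ "(fst x, s * fst x)"] bexI[of _ "(0, snd x - s * fst x)"])
      (auto simp: prod_eq_iff)
  then show ?thesis
    unfolding complementary_def eigenspace_times by (auto simp: zero_prod_def simp del: split_paired_All)
qed

end

text \<open>In the splitting of the complexification into the eigenspaces \<open>{(v, s v)}\<close> and \<open>{(u, - s u)}\<close>,
  this is the map \<open>(v, s v) \<mapsto> (t v, - s t v)\<close>.\<close>

definition eigen_hom ::
    "'a::{real_algebra_1, euclidean_space} \<Rightarrow> 'a \<Rightarrow> 'a complexification \<Rightarrow>\<^sub>L 'a complexification" where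
  "eigen_hom s t =
     Blinfun (\<lambda>z. let v = (1 / 2) *\<^sub>R (fst z - s * snd z) in (t * v, - (s * (t * v))))"

lemma eigen_hom_apply:
  "blinfun_apply (eigen_hom s t) z =
     (let v = (1 / 2) *\<^sub>R (fst z - s * snd z) in (t * v, - (s * (t * v))))"
proof -
  have "linear (\<lambda>z. let v = (1 / 2) *\<^sub>R (fst z - s * snd z) in (t * v, - (s * (t * v))))"
    unfolding Let_def by (auto intro!: linearI simp: algebra_simps)
  then show ?thesis
    unfolding eigen_hom_def linear_conv_bounded_linear by (simp only: bounded_linear_Blinfun_apply)
qed

lemma bounded_linear_eigen_hom: "bounded_linear (eigen_hom s)"
  unfolding linear_conv_bounded_linear[symmetric]
  by (auto intro!: linearI blinfun_eqI simp: eigen_hom_apply Let_def algebra_simps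
      blinfun.bilinear_simps)

text \<open>A linear left inverse of \<open>eigen_hom s\<close> that does not depend on s: the
  component of \<open>(2, 0)\<close> in the eigenspace of s is (1, s), which
  \<open>eigen_hom s t\<close> sends to a vector with first entry t.\<close>

definition eigen_param ::
    "('a::{real_algebra_1, euclidean_space} complexification \<Rightarrow>\<^sub>L 'a complexification) \<Rightarrow> 'a" where
  "eigen_param T = fst (blinfun_apply T (2 *\<^sub>R 1, 0))"

lemma eigen_param_eigen_hom [simp]: "eigen_param (eigen_hom s t) = t"
  by (simp add: eigen_param_def eigen_hom_apply Let_def)

lemma bounded_linear_eigen_param: "bounded_linear eigen_param"
  unfolding eigen_param_def[abs_def]
  by (intro bounded_linear_fst_comp blinfun.bounded_linear_left)

text \<open>The condition on the domain excludes the graphs of \<open>eigen_hom s t\<close> with 1 +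
  t singular: they meet {0} \<times> UNIV nontrivially and are not eigenspaces of units.\<close>

definition flat_base ::
    "'a::{real_algebra_1, euclidean_space} \<Rightarrow>
     ('a complexification set, 'a complexification \<Rightarrow>\<^sub>L 'a complexification) cchart" where
  "flat_base s =
     (let c = grassmannian_chart (DIM('a) div 2) (eigenspace s) (eigenspace (- s))
      in c\<lparr>cdom := {W \<in> cdom c. complementary W ({0} \<times> UNIV)}\<rparr>)"

definition flat_chart ::
    "'a::{real_algebra_1, euclidean_space} \<Rightarrow>
     ('a complexification set, 'a complexification \<Rightarrow>\<^sub>L 'a complexification) cchart" where
  "flat_chart s =
     (flat_base s)\<lparr>cdom := cdom (flat_base s) \<inter> eigenspace ` imaginary_units,
       cmodel := eigen_hom s ` anticommutant s\<rparr>"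

lemma inj_eigenspace: "inj (eigenspace :: 'a::real_algebra_1 \<Rightarrow> _)"
proof (rule injI)
  fix s s' :: 'a assume "eigenspace s = eigenspace s'"
  then have "(1, s * 1) \<in> range (\<lambda>v. (v, s' * v))"
    unfolding eigenspace_times by blast
  then show "s = s'"
    by auto
qed

section \<open>Anticommuting elements as linear coordinates on the image in the Grassmannian\<close>

context
  fixes s :: "'a::{real_algebra_1, euclidean_space}"
  assumes s: "s \<in> imaginary_units"
begin

lemma eigen_splitting:
  "eigenspace s \<in> complex_grassmannian (DIM('a) div 2)"
  "module.subspace scaleC (eigenspace (- s))"
  "complementary (eigenspace s) (eigenspace (- s))"
  using eigenspace_in_grassmannian[OF s] eigenspace_in_grassmannian[of "- s"] s
    eigenspaces_complementary[OF s] by (simp_all add: complex_grassmannian_def)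

text \<open>In the coordinate v of (v, s v) multiplication by \<i> is v |-> - s v; in the coordinate
  u of (u, - s u) it is u |-> s u. So u = t v is complex linear precisely when - t s = s t.\<close>

lemma eigen_hom_in_complex_hom:
  assumes t: "t \<in> anticommutant s"
  shows "eigen_hom s t \<in> complex_hom (eigenspace s) (eigenspace (- s))"
proof (rule complex_homI)
  note ts = anticommutantD[OF t]
  fix z :: "'a complexification"
  define v where "v = (1 / 2) *\<^sub>R (fst z - s * snd z)"
  have "(1 / 2) *\<^sub>R (- snd z - s * fst z) = - (s * v)"
    by (simp add: v_def imaginary_unit_cancel[OF s] algebra_simps)
  moreover have "t * (s * v) = - (s * (t * v))"
    using ts by (metis mult.assoc mult_minus_left)
  ultimately show "blinfun_apply (eigen_hom s t) (scaleC \<i> z) = scaleC \<i> (blinfun_apply (eigen_hom s t) z)"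
    by (simp add: eigen_hom_apply scaleC_i Let_def v_def[symmetric] imaginary_unit_cancel[OF s]
        del: scaleR_right_diff_distrib)
  show "blinfun_apply (eigen_hom s t) z \<in> eigenspace (- s)"
    unfolding eigenspace_times eigen_hom_apply Let_def mult_minus_left[symmetric] by (rule rangeI)
  show "blinfun_apply (eigen_hom s t) z = 0" if "z \<in> eigenspace (- s)"
    using that unfolding eigenspace_times
    by (auto simp: eigen_hom_apply Let_def imaginary_unit_cancel[OF s] zero_prod_def)
qed

text \<open>On (u, - s u) multiplication by \<i> acts as u |-> s u; thus \<open>eigen_hom s\<close>
  takes left multiplication by \<open>s\<close> to the complex structure of the Grassmannian
  chart.\<close>

lemma times_i_eigen_hom:
  assumes t: "t \<in> anticommutant s"
  shows "times_i o\<^sub>L eigen_hom s t = eigen_hom s (s * t)"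
  by (rule blinfun_eqI)
    (simp add: times_i_apply eigen_hom_apply Let_def scaleC_i mult.assoc imaginary_unit_cancel[OF s])

lemma shear_eigen_hom:
  "shear (eigen_hom s t) (eigenspace s) = range (\<lambda>v. ((1 + t) * v, s * (1 - t) * v))"
  unfolding shear_def eigenspace_times image_image
  by (auto simp: eigen_hom_apply Let_def imaginary_unit_cancel[OF s] algebra_simps simp flip: scaleR_2
      intro!: image_cong)

text \<open>The graph consists of the vectors ((1 + t) v, s (1 - t) v). Here s (1 - t) = x (1 + t),
  and (1 + t) v runs through the whole algebra.\<close>

lemma shear_cayley:
  assumes x: "x \<in> cayley_dom s" "x \<in> imaginary_units"
  shows "shear (eigen_hom s (cayley s x)) (eigenspace s) = eigenspace x"
proof -
  let ?t = "cayley s x"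
  have t: "?t \<in> cayley_ran" "?t \<in> anticommutant s"
    using cayley_image_units[OF s] x by blast+
  have inv: "1 + ?t \<in> invertibles"
    using t by (simp add: cayley_ran_def)
  have "s * (1 - ?t) = x * (1 + ?t)"
    using cayley_inv_intertwines(1)[OF s t] cayley_inv_cayley[OF s x(1)] by simp
  then have "((1 + ?t) * v, s * (1 - ?t) * v) = ((1 + ?t) * v, x * ((1 + ?t) * v))" for v
    by (simp add: mult.assoc)
  moreover have "range (\<lambda>v. (1 + ?t) * v) = UNIV"
    using minv_cancel(1)[OF inv] by (metis surjI)
  then have "range (\<lambda>v. ((1 + ?t) * v, x * ((1 + ?t) * v))) = range (\<lambda>v. (v, x * v))"
    using image_image[of "\<lambda>v. (v, x * v)" "\<lambda>v. (1 + ?t) * v" UNIV] by simp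
  ultimately show ?thesis
    unfolding shear_eigen_hom unfolding eigenspace_times by simp
qed

lemma cdom_flat_base:
  "cdom (flat_base s) = {W \<in> cdom (grassmannian_chart (DIM('a) div 2) (eigenspace s) (eigenspace (- s))).
     complementary W ({0} \<times> UNIV)}"
  by (simp add: flat_base_def Let_def)

lemma flat_base_simps:
  "cmap (flat_base s) = cmap (grassmannian_chart (DIM('a) div 2) (eigenspace s) (eigenspace (- s)))"
  "cmodel (flat_base s) = complex_hom (eigenspace s) (eigenspace (- s))"
  "cstruct (flat_base s) T = times_i o\<^sub>L T"
  by (simp_all add: flat_base_def Let_def cstruct_grassmannian_chart
      cmodel_grassmannian_chart[OF eigen_splitting])

lemma flat_base_maximal: "flat_base s \<in> maximal_atlas (grassmannian_atlas (DIM('a) div 2))"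
proof -
  let ?c = "grassmannian_chart (DIM('a) div 2) (eigenspace s) (eigenspace (- s))"
  have "?c \<in> grassmannian_atlas (DIM('a) div 2)"
    unfolding grassmannian_atlas_def using eigen_splitting by blast
  moreover have "subspace ({0 :: 'a} \<times> (UNIV :: 'a set))"
    by (intro subspace_Times subspace_UNIV) simp
  note openin_complementary[OF eigen_splitting this]
  ultimately show ?thesis
    unfolding flat_base_def Let_def
    by (intro maximal_atlas_restrict complex_atlas_grassmannian)
      (auto simp: cmodel_grassmannian_chart[OF eigen_splitting])
qed

text \<open>The eigenspaces of x and - s meet in the vectors (v, x v) with x v = - s v, that is with
  (1 - s x) v = 0. Transversality to the second one therefore makes 1 - s x invertible.\<close>

lemma eigenspace_in_flat_base:
  assumes x: "x \<in> imaginary_units"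
  shows "eigenspace x \<in> cdom (flat_base s) \<longleftrightarrow> x \<in> cayley_dom s"
proof
  assume "x \<in> cayley_dom s"
  then have "cayley s x \<in> anticommutant s" and shear: "shear (eigen_hom s (cayley s x)) (eigenspace s) = eigenspace x"
    using x cayley_anticommutant[OF s] shear_cayley by auto
  from shear_in_cdom[OF eigen_splitting eigen_hom_in_complex_hom[OF this(1)]]
  show "eigenspace x \<in> cdom (flat_base s)"
    unfolding cdom_flat_base shear using eigenspace_complementary_imaginary[OF x] by simp
next
  assume "eigenspace x \<in> cdom (flat_base s)"
  then have compl: "complementary (eigenspace x) (eigenspace (- s))"
    unfolding cdom_flat_base by (simp add: cdom_grassmannian_chart[OF eigen_splitting])
  have "1 - s * x \<in> invertibles"
  proof (rule invertibles_if_inj)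
    fix v assume "(1 - s * x) * v = 0"
    then have "v = s * (x * v)"
      by (simp add: left_diff_distrib mult.assoc)
    then have "- s * v = x * v"
      using imaginary_unit_cancel(2)[OF s, of "x * v"] by simp
    then have "(v, x * v) \<in> eigenspace x \<inter> eigenspace (- s)"
      unfolding eigenspace_times by (metis IntI rangeI)
    moreover have "eigenspace x \<inter> eigenspace (- s) = {0}"
      using compl unfolding complementary_def by blast
    ultimately have "(v, x * v) = (0 :: 'a complexification)"
      by blast
    then show "v = 0"
      by (simp add: zero_prod_def)
  qed
  then show "x \<in> cayley_dom s"
    by (simp add: cayley_dom_def)
qed

lemma cdom_flat_chart:
  "cdom (flat_chart s) = eigenspace ` (cayley_dom s \<inter> imaginary_units)"
  unfolding flat_chart_def using eigenspace_in_flat_base by auto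

lemma flat_chart_simps:
  "cmap (flat_chart s) = cmap (flat_base s)"
  "cmodel (flat_chart s) = eigen_hom s ` anticommutant s"
  "cstruct (flat_chart s) = cstruct (flat_base s)"
  by (simp_all add: flat_chart_def)

lemma cmap_flat_base:
  assumes x: "x \<in> cayley_dom s" "x \<in> imaginary_units"
  shows "cmap (flat_base s) (eigenspace x) = eigen_hom s (cayley s x)"
  unfolding flat_base_simps shear_cayley[OF x, symmetric]
  by (intro cmap_shear[OF eigen_splitting] eigen_hom_in_complex_hom cayley_anticommutant s x)

lemma flat_base_image:
  "cmap (flat_base s) ` cdom (flat_chart s) =
     cmap (flat_base s) ` cdom (flat_base s) \<inter> eigen_hom s ` anticommutant s"
proof (intro equalityI subsetI)
  fix T assume "T \<in> cmap (flat_base s) ` cdom (flat_chart s)"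
  then obtain x where x: "x \<in> cayley_dom s" "x \<in> imaginary_units" "T = cmap (flat_base s) (eigenspace x)"
    unfolding cdom_flat_chart by auto
  then show "T \<in> cmap (flat_base s) ` cdom (flat_base s) \<inter> eigen_hom s ` anticommutant s"
    using cmap_flat_base[OF x(1,2)] eigenspace_in_flat_base[OF x(2)] cayley_anticommutant[OF s x(1,2)]
    by blast
next
  fix T assume "T \<in> cmap (flat_base s) ` cdom (flat_base s) \<inter> eigen_hom s ` anticommutant s"
  then obtain W t where W: "W \<in> cdom (flat_base s)" "T = cmap (flat_base s) W"
    and t: "t \<in> anticommutant s" "T = eigen_hom s t"
    by auto
  have "W = shear (eigen_hom s t) (eigenspace s)"
    using shear_cmap(1)[OF eigen_splitting, of W] W t unfolding cdom_flat_base flat_base_simps by simp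
  then have WR: "W = range (\<lambda>v. ((1 + t) * v, s * (1 - t) * v))"
    by (simp only: shear_eigen_hom)
  \<comment> \<open>If (1 + t) v = 0, the graph contains (0, s (1 - t) v), so the condition on the
    domain gives (1 - t) v = 0; adding the two equations yields 2 v = 0.\<close>
  have "1 + t \<in> invertibles"
  proof (rule invertibles_if_inj)
    fix v assume v: "(1 + t) * v = 0"
    then have "(0, s * (1 - t) * v) \<in> W \<inter> ({0} \<times> UNIV)"
      unfolding WR by (auto simp: image_iff intro!: exI[of _ v])
    moreover have "W \<inter> ({0} \<times> UNIV) = {0}"
      using W(1) unfolding cdom_flat_base complementary_def by blast
    ultimately have "(0, s * (1 - t) * v) = (0 :: 'a complexification)"
      by blast
    then have "s * (s * ((1 - t) * v)) = 0"
      by (simp add: zero_prod_def mult.assoc)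
    then have "v - t * v = 0"
      by (simp add: imaginary_unit_cancel[OF s] left_diff_distrib)
    then have "2 *\<^sub>R v = 0"
      using v by (simp add: scaleR_2 distrib_right)
    then show "v = 0"
      by simp
  qed
  then have "t \<in> cayley_ran \<inter> anticommutant s"
    using t by (simp add: cayley_ran_def)
  then obtain x where x: "x \<in> cayley_dom s" "x \<in> imaginary_units" "t = cayley s x"
    unfolding cayley_image_units[OF s, symmetric] by auto
  then show "T \<in> cmap (flat_base s) ` cdom (flat_chart s)"
    using cmap_flat_base[OF x(1,2)] t(2) unfolding cdom_flat_chart
    by (intro image_eqI[of _ _ "eigenspace x"]) auto
qed

lemma flat_chart_submanifold:
  "flat_chart s \<in> submanifold_atlas (grassmannian_atlas (DIM('a) div 2))
     (eigenspace ` imaginary_units)"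
proof -
  let ?F = "eigen_hom s ` anticommutant s"
  have "subspace ?F"
    by (intro linear_subspace_image subspace_anticommutant bounded_linear.linear bounded_linear_eigen_hom)
  moreover have "?F \<subseteq> cmodel (flat_base s)"
    using eigen_hom_in_complex_hom by (auto simp: flat_base_simps)
  moreover have "cstruct (flat_base s) ` ?F \<subseteq> ?F"
    using times_i_eigen_hom times_anticommutant[OF s] by (auto simp: flat_base_simps)
  moreover have "cmap (flat_base s) ` (cdom (flat_base s) \<inter> eigenspace ` imaginary_units) =
      cmap (flat_base s) ` cdom (flat_base s) \<inter> ?F"
    using flat_base_image by (simp add: flat_chart_def)
  ultimately show ?thesis
    unfolding submanifold_atlas_def flat_chart_def using flat_base_maximal by blast
qed

text \<open>The model consists of the fixed points of the continuous map
  \<open>eigen_hom s \<circ> eigen_param\<close> whose parameter lies in the anticommutant, a closed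
  subspace.\<close>

lemma closed_cmodel_flat_chart: "closed (cmodel (flat_chart s))"
proof -
  have "cmodel (flat_chart s) = {T. eigen_hom s (eigen_param T) = T \<and> eigen_param T \<in> anticommutant s}"
    unfolding flat_chart_simps by (auto simp: image_iff) metis
  moreover have "closed {T. eigen_hom s (eigen_param T) = T}"
    by (intro closed_Collect_eq continuous_intros linear_continuous_on
        bounded_linear_compose[OF bounded_linear_eigen_hom bounded_linear_eigen_param])
  moreover have "closed {T. eigen_param T \<in> anticommutant s}"
    using closed_vimage[OF closed_subspace[OF subspace_anticommutant]
        linear_continuous_on[OF bounded_linear_eigen_param]] by (simp add: vimage_def)
  ultimately show ?thesis
    by (simp add: closed_Collect_conj)
qed

lemma eigenspace_holo: "holo_in_charts (cayley_chart s) (flat_chart s) eigenspace"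
proof -
  let ?w = "eigenspace :: 'a \<Rightarrow> _"
  let ?c = "cayley_chart s" and ?d = "flat_chart s"
  have c: "complex_chart ?c"
    using cayley_chart_holomorphic[OF s] by (simp add: holomorphic_charts_def)
  have W: "{x \<in> cdom ?c. ?w x \<in> cdom ?d} = cdom ?c"
    by (auto simp: cdom_flat_chart cayley_chart_def)
  have "\<exists>D. ((\<lambda>z. cmap ?d (?w (inv_into (cdom ?c) (cmap ?c) z))) has_derivative D)
        (at (cmap ?c x) within cmap ?c ` cdom ?c) \<and>
      (\<forall>v\<in>cmodel ?c. D (cstruct ?c v) = cstruct ?d (D v))" if x: "x \<in> cdom ?c" for x
  proof (intro exI conjI ballI)
    have "(eigen_hom s has_derivative eigen_hom s) (at (cmap ?c x) within cmap ?c ` cdom ?c)"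
      by (intro bounded_linear_imp_has_derivative bounded_linear_eigen_hom)
    then show "((\<lambda>z. cmap ?d (?w (inv_into (cdom ?c) (cmap ?c) z))) has_derivative eigen_hom s)
        (at (cmap ?c x) within cmap ?c ` cdom ?c)"
    proof (rule has_derivative_transform[rotated 2])
      fix z assume "z \<in> cmap ?c ` cdom ?c"
      then show "cmap ?d (?w (inv_into (cdom ?c) (cmap ?c) z)) = eigen_hom s z"
        using complex_chart_simps(2)[OF c] by (auto simp: cayley_chart_def flat_chart_simps cmap_flat_base)
    qed (use x in auto)
    show "eigen_hom s (cstruct ?c v) = cstruct ?d (eigen_hom s v)" if "v \<in> cmodel ?c" for v
      using times_i_eigen_hom that by (simp add: cayley_chart_def flat_chart_simps flat_base_simps)
  qed
  then show ?thesis
    unfolding holo_in_charts_def holo_on_def Let_def W using complex_chart_simps(3)[OF c] by blast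
qed

text \<open>On the flat model the coordinate expression agrees with \<open>eigen_param\<close>,
  which is linear on the whole operator space and so supplies the derivative directly.\<close>

lemma inv_eigenspace_holo:
  "holo_in_charts (flat_chart s) (cayley_chart s) (inv_into imaginary_units eigenspace)"
proof -
  let ?w = "eigenspace :: 'a \<Rightarrow> _" and ?S = "imaginary_units :: 'a set"
  let ?c = "flat_chart s" and ?d = "cayley_chart s"
  have c: "complex_chart ?c"
    using flat_chart_submanifold by (rule submanifold_atlas_chart)
  have inv: "inv_into ?S ?w (?w x) = x" if "x \<in> ?S" for x
    using that inj_on_subset[OF inj_eigenspace] by (intro inv_into_f_f) auto
  have W: "{x \<in> cdom ?c. inv_into ?S ?w x \<in> cdom ?d} = cdom ?c"
    by (auto simp: cdom_flat_chart cayley_chart_def inv)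
  have "\<exists>D. ((\<lambda>z. cmap ?d (inv_into ?S ?w (inv_into (cdom ?c) (cmap ?c) z))) has_derivative D)
        (at (cmap ?c x) within cmap ?c ` cdom ?c) \<and>
      (\<forall>v\<in>cmodel ?c. D (cstruct ?c v) = cstruct ?d (D v))" if x: "x \<in> cdom ?c" for x
  proof (intro exI conjI ballI)
    have "(eigen_param has_derivative eigen_param) (at (cmap ?c x) within cmap ?c ` cdom ?c)"
      by (intro bounded_linear_imp_has_derivative bounded_linear_eigen_param)
    then show "((\<lambda>z. cmap ?d (inv_into ?S ?w (inv_into (cdom ?c) (cmap ?c) z))) has_derivative eigen_param)
        (at (cmap ?c x) within cmap ?c ` cdom ?c)"
    proof (rule has_derivative_transform[rotated 2])
      fix z assume "z \<in> cmap ?c ` cdom ?c"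
      then obtain y where y: "y \<in> cayley_dom s" "y \<in> ?S" "z = cmap ?c (?w y)" "?w y \<in> cdom ?c"
        unfolding cdom_flat_chart by blast
      then have "inv_into (cdom ?c) (cmap ?c) z = ?w y"
        using complex_chart_simps(2)[OF c] by simp
      then show "cmap ?d (inv_into ?S ?w (inv_into (cdom ?c) (cmap ?c) z)) = eigen_param z"
        using y inv by (simp add: cayley_chart_def flat_chart_simps cmap_flat_base)
    qed (use x in auto)
    show "eigen_param (cstruct ?c v) = cstruct ?d (eigen_param v)" if "v \<in> cmodel ?c" for v
      using times_i_eigen_hom that by (auto simp: cayley_chart_def flat_chart_simps flat_base_simps)
  qed
  then show ?thesis
    unfolding holo_in_charts_def holo_on_def Let_def W using complex_chart_simps(3)[OF c] by blast
qed

end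

theorem theoremA:
  fixes S :: "'a::{real_algebra_1, euclidean_space} set"
    and J :: "'a \<Rightarrow> 'a \<Rightarrow> 'a"
    and w :: "'a \<Rightarrow> 'a complexification set"
    and Gr :: "('a complexification set, 'a complexification \<Rightarrow>\<^sub>L 'a complexification) cchart set"
  assumes S: "S = imaginary_units"
    and J: "J = (\<lambda>s h. s * h)"
    and w: "w = (\<lambda>s. \<W> (\<lambda>x. s * x))"
    and Gr: "Gr = grassmannian_atlas (DIM('a) div 2)"
  shows "(real_algebraic_set S \<and> smooth_submanifold S) \<and>
    (almost_complex_structure S J \<and> integrable_structure S J) \<and>
    (complex_submanifold Gr (w ` S) \<and>
     biholomorphism (holomorphic_charts S J) (submanifold_atlas Gr (w ` S)) w)"
proof -
  have w: "w = eigenspace"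
    by (simp add: w eigenspace_def fun_eq_iff)
  let ?A = "holomorphic_charts S J" and ?B = "submanifold_atlas Gr (w ` S)"
  have J': "J = (*)"
    by (simp add: J)
  have atlas: "complex_atlas Gr" "\<And>d. d \<in> Gr \<Longrightarrow> closed (cmodel d)"
    unfolding Gr by (rule complex_atlas_grassmannian closed_cmodel_grassmannian; assumption)+
  have integrable: "integrable_structure S J"
    unfolding S J' by (rule integrable_structure_imaginary_units)
  have chartA: "complex_chart c \<and> cdom c \<subseteq> S" if "c \<in> ?A" for c
    using that openin_imp_subset by (auto simp: holomorphic_charts_def)
  have AA: "holo_in_charts c c' (\<lambda>x. x)" if "c \<in> ?A" "c' \<in> ?A" for c c'
    using that holomorphic_charts_compatible unfolding S J' by blast
  have BB: "holo_in_charts c c' (\<lambda>x. x)" if "c \<in> ?B" "c' \<in> ?B" for c c'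
    using submanifold_atlas_compatible[OF atlas that] .
  have cay: "cayley_chart s \<in> ?A" "complex_chart (cayley_chart s)" "closed (cmodel (cayley_chart s))"
    "s \<in> cdom (cayley_chart s)" if "s \<in> S" for s
  proof -
    show "cayley_chart s \<in> ?A"
      using cayley_chart_holomorphic that unfolding S J' by blast
    then show "complex_chart (cayley_chart s)"
      using chartA by blast
    show "closed (cmodel (cayley_chart s))"
      using closed_subspace[OF subspace_anticommutant] by (simp add: cayley_chart_def)
    show "s \<in> cdom (cayley_chart s)"
      using cayley_dom_self that by (simp add: cayley_chart_def S)
  qed
  have flat: "flat_chart s \<in> ?B" "complex_chart (flat_chart s)" "closed (cmodel (flat_chart s))"
    "cdom (flat_chart s) = w ` cdom (cayley_chart s)" if "s \<in> S" for s
  proof -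
    show B: "flat_chart s \<in> ?B"
      using flat_chart_submanifold that unfolding S Gr w by blast
    show "complex_chart (flat_chart s)"
      by (rule submanifold_atlas_chart[OF B])
    show "closed (cmodel (flat_chart s))"
      using closed_cmodel_flat_chart that unfolding S by blast
    show "cdom (flat_chart s) = w ` cdom (cayley_chart s)"
      using cdom_flat_chart that by (simp add: cayley_chart_def S w)
  qed
  have chartB: "complex_chart d \<and> cdom d \<subseteq> w ` S" if "d \<in> ?B" for d
    using submanifold_atlas_chart[OF that] that by (auto simp: submanifold_atlas_def)
  have carrierA: "atlas_carrier ?A = S"
    unfolding atlas_carrier_def
  proof (intro equalityI subsetI)
    show "x \<in> (\<Union>c\<in>?A. cdom c)" if "x \<in> S" for x
      using cay(1,4)[OF that] by (rule UN_I)
  qed (use chartA in blast)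
  have carrierB: "atlas_carrier ?B = w ` S"
    unfolding atlas_carrier_def
  proof (intro equalityI subsetI)
    fix W assume "W \<in> w ` S"
    then obtain x where x: "x \<in> S" "W = w x"
      by blast
    then have "W \<in> cdom (flat_chart x)"
      using flat(4) cay(4) by blast
    then show "W \<in> (\<Union>d\<in>?B. cdom d)"
      using flat(1)[OF x(1)] by blast
  qed (use chartB in blast)
  have inj: "inj_on w S"
    using inj_on_subset[OF inj_eigenspace] unfolding w by blast
  define w' where "w' = inv_into S w"
  have w': "w' (w x) = x" if "x \<in> S" for x
    using inj that by (simp add: w'_def)
  have holo: "holo_in_charts (cayley_chart s) (flat_chart s) w" if "s \<in> S" for s
    using eigenspace_holo that unfolding S w by blast
  have holo': "holo_in_charts (flat_chart s) (cayley_chart s) w'" if "s \<in> S" for s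
    using inv_eigenspace_holo that unfolding S w w'_def by blast
  \<comment> \<open>An arbitrary chart of the image is reached from the flat chart at
    \<open>s\<close> by a holomorphic coordinate change.\<close>
  have wB: "holo_in_charts (cayley_chart s) d w" if s: "s \<in> S" and d: "d \<in> ?B" for s d
  proof (rule holo_in_charts_compose[OF cay(2)[OF s], where g = "\<lambda>x. x"])
    fix x assume "x \<in> cdom (cayley_chart s)"
    then show "\<exists>e :: ('a complexification set, 'a complexification \<Rightarrow>\<^sub>L 'a complexification) cchart.
        complex_chart e \<and> closed (cmodel e) \<and> w x \<in> cdom e \<and>
        holo_in_charts (cayley_chart s) e w \<and> holo_in_charts e d (\<lambda>x. x)"
      using flat[OF s] holo[OF s] BB[OF flat(1)[OF s] d] by blast
  qed simp
  have wA: "holo_in_charts (flat_chart s) c w'" if s: "s \<in> S" and c: "c \<in> ?A" for s c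
  proof (rule holo_in_charts_compose[OF flat(2)[OF s], where g = "\<lambda>x. x"])
    fix x assume "x \<in> cdom (flat_chart s)"
    then have "w' x \<in> cdom (cayley_chart s)"
      using flat(4)[OF s] w' chartA[OF cay(1)[OF s]] by (auto simp: subset_iff)
    then show "\<exists>e :: ('a, 'a) cchart. complex_chart e \<and> closed (cmodel e) \<and> w' x \<in> cdom e \<and>
        holo_in_charts (flat_chart s) e w' \<and> holo_in_charts e c (\<lambda>x. x)"
      using cay[OF s] holo'[OF s] AA[OF cay(1)[OF s] c] by blast
  qed simp
  \<comment> \<open>An arbitrary chart of the units is left through the Cayley chart at the point in
    question, so the intermediate chart varies with the point.\<close>
  have "holo_in_charts c d w" if c: "c \<in> ?A" and d: "d \<in> ?B" for c d
  proof (rule holo_in_charts_compose[where f = "\<lambda>x. x" and g = w])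
    fix x assume "x \<in> cdom c"
    then have x: "x \<in> S"
      using chartA[OF c] by blast
    then show "\<exists>e :: ('a, 'a) cchart. complex_chart e \<and> closed (cmodel e) \<and> x \<in> cdom e \<and>
        holo_in_charts c e (\<lambda>x. x) \<and> holo_in_charts e d w"
      using cay[OF x] AA[OF c cay(1)[OF x]] wB[OF x d] by blast
  qed (use chartA[OF c] in auto)
  moreover have "holo_in_charts d c w'" if c: "c \<in> ?A" and d: "d \<in> ?B" for c d
  proof (rule holo_in_charts_compose[where f = "\<lambda>x. x" and g = w'])
    fix y assume "y \<in> cdom d"
    then obtain x where x: "x \<in> S" "y = w x"
      using chartB[OF d] by blast
    then show "\<exists>e :: ('a complexification set, 'a complexification \<Rightarrow>\<^sub>L 'a complexification) cchart.
        complex_chart e \<and> closed (cmodel e) \<and> y \<in> cdom e \<and>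
        holo_in_charts d e (\<lambda>x. x) \<and> holo_in_charts e c w'"
      using flat[OF x(1)] cay(4)[OF x(1)] BB[OF d flat(1)[OF x(1)]] wA[OF x(1) c] by blast
  qed (use chartB[OF d] in auto)
  moreover have "bij_betw w S (w ` S)" "w' ` w ` S \<subseteq> S"
    using inj w' by (auto simp: bij_betw_def)
  ultimately have "biholomorphism ?A ?B w"
    unfolding biholomorphism_def holomorphic_map_def carrierA carrierB w'_def[symmetric] by blast
  moreover have "complex_submanifold Gr (w ` S)"
    using atlas carrierB by (simp add: complex_submanifold_def)
  ultimately show ?thesis
    using integrable real_algebraic_imaginary_units smooth_submanifold_imaginary_units
      almost_complex_structure_imaginary_units unfolding S J' by blast
qed

end
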